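(* Suppose assumptions (A1)–(A4) of the context hold and $\mu\ge\hat\mu$. Then, at any iteration $\tau\ge0$, the approximate Newton direction $(\tilde\Delta\boldsymbol x,\tilde\Delta\boldsymbol\lambda)$ computed by overlapping graph decomposition with overlap size $b$ satisfies $$\|(\tilde\Delta\boldsymbol x-\Delta\boldsymbol x,\ \tilde\Delta\boldsymbol\lambda-\Delta\boldsymbol\lambda)\|\le\Upsilon_{\mu,b}\cdot\rho_\mu^{b}\,\|(\Delta\boldsymbol x,\Delta\boldsymbol\lambda)\|,$$ where $(\Delta\boldsymbol x,\Delta\boldsymbol\lambda)$ is the exact Newton direction and $$\Upsilon_{\mu,b}:=\frac{\sqrt2\,\Upsilon_\mu\Upsilon_K}{\rho_\mu\sqrt{1-\rho_\mu^2}}\cdot\mathrm{poly}_{\mathcal G\circ\mathcal W}(b)\,\{\mathrm{poly}_{\mathcal G}(b+2)\}^{1/2}.$$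
   Context: Graph notation. $\mathcal G=(\mathcal V,\mathcal E)$ is a finite undirected graph with strictly ordered node set; $d_{\mathcal G}(i,j)$ is the number of edges of a shortest path between $i$ and $j$, and $d_{\mathcal G}(i,\mathcal W)$ is the distance from $i$ to the set $\mathcal W$. $N^b_{\mathcal G}[\mathcal W]=\{i\in\mathcal V:d_{\mathcal G}(i,\mathcal W)\le b\}$, $N_{\mathcal G}[\mathcal W]=N^1_{\mathcal G}[\mathcal W]$, $N_{\mathcal G}(\mathcal W)=N_{\mathcal G}[\mathcal W]\setminus\mathcal W$, $N_{\mathcal G}[i]=N_{\mathcal G}[\{i\}]$, $[M]=\{1,\dots,M\}$. Problem. The graph-structured nonlinear program is $\min\sum_{i\in\mathcal V}f_i(\{\boldsymbol x_j\}_{j\in N_{\mathcal G}[i]})$ subject to $\boldsymbol c_i(\{\boldsymbol x_j\}_{j\in N_{\mathcal G}[i]})=\boldsymbol 0$, $i\in\mathcal V$, with $\boldsymbol x_i\in\mathbb R^{r_i}$, $f_i$ real valued, $\boldsymbol c_i$ valued in $\mathbb R^{m_i}$, all twice continuously differentiable, and dual variables $\boldsymbol\lambda_i\in\mathbb R^{m_i}$. Put $f=\sum_if_i$, $\boldsymbol c=\{\boldsymbol c_i\}_{i\in\mathcal V}$, $\mathcal L(\boldsymbol x,\boldsymbol\lambda)=f(\boldsymbol x)+\boldsymbol\lambda^T\boldsymbol c(\boldsymbol x)$. At iterates $(\boldsymbol x^\tau,\boldsymbol\lambda^\tau)$, $\tau=0,1,\dots$, write $\boldsymbol c^\tau=\boldsymbol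 c(\boldsymbol x^\tau)$, $\nabla\mathcal L^\tau=\nabla\mathcal L(\boldsymbol x^\tau,\boldsymbol\lambda^\tau)$, $G^\tau=\nabla\boldsymbol c(\boldsymbol x^\tau)$ (constraint Jacobian), $H^\tau=\nabla^2_{\boldsymbol x}\mathcal L(\boldsymbol x^\tau,\boldsymbol\lambda^\tau)$, and let $\hat H^\tau$ be a symmetric structure-preserving modification of $H^\tau$. Vectors and matrices are indexed blockwise by nodes; $A_{i,j}$ is the $(i,j)$-block and $A[\mathcal I][\mathcal J]$ (or $v[\mathcal I]$) the subarray with row indices in $\mathcal I$ and column indices in $\mathcal J$. Thus $H^\tau_{i,j}=\hat H^\tau_{i,j}=\boldsymbol0$ if $d_{\mathcal G}(i,j)>2$ and $G^\tau_{i,j}=\boldsymbol0$ if $d_{\mathcal G}(i,j)>1$. $\|\cdot\|$ is the Euclidean/spectral norm. Exact Newton direction at iteration $\tau$ (index suppressed): the solution of $\begin{bmatrix}\hat H^\tau & (G^\tau)^T \\ G^\tau & \boldsymbol0\end{bmatrix}\begin{bmatrix}\Delta\boldsymbol x \\ \Delta\boldsymbol\lambda\end{bmatrix}=-\begin{bmatrix}\nabla_{\boldsymbol x}\mathcal L^\tau \\ \nabla_{\boldsymbol\lambda}\mathcal L^\tau\end{bmatrix}$. Overlapping decomposition. $\{\mathcal V_\ell\}_{\ell\in[M]}$ is a disjoint partition of $\mathcal V$, $b\ge1$ is an integer (overlap size), and $\mathcal W_\ell\subseteq\mathcal V$ satisfies $N^b_{\mathcal G}[\mathcal V_\ell]\subseteq\mathcal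 W_\ell$. Set $\tilde{\mathcal W}_\ell=N_{\mathcal G}(N_{\mathcal G}(\mathcal W_\ell))\cap\mathcal W_\ell$ and $\hat{\mathcal W}_\ell=N_{\mathcal G}(\mathcal W_\ell)\cup\tilde{\mathcal W}_\ell$. Approximate Newton direction at iteration $\tau$ (index suppressed): for each $\ell\in[M]$ let $(\tilde{\boldsymbol\omega}^*_\ell,\tilde{\boldsymbol\zeta}^*_\ell)$ be the primal-dual solution (unique for $\mu\ge\hat\mu$) of $$\min_{\tilde{\boldsymbol\omega}_\ell}\ \tfrac12\tilde{\boldsymbol\omega}_\ell^T\hat H^\tau[\mathcal W_\ell][\mathcal W_\ell]\tilde{\boldsymbol\omega}_\ell+\tilde{\boldsymbol\omega}_\ell^T\nabla_{\boldsymbol x}\mathcal L^\tau[\mathcal W_\ell]+\tfrac\mu2\|\boldsymbol c^\tau[\hat{\mathcal W}_\ell]+G^\tau[\hat{\mathcal W}_\ell][\mathcal W_\ell]\tilde{\boldsymbol\omega}_\ell\|^2\ \ \text{s.t.}\ \ \boldsymbol c^\tau[\mathcal W_\ell\setminus\tilde{\mathcal W}_\ell]+G^\tau[\mathcal W_\ell\setminus\tilde{\mathcal W}_\ell][\mathcal W_\ell]\tilde{\boldsymbol\omega}_\ell=\boldsymbol0,$$ where $\tilde{\boldsymbol\omega}_\ell$ is indexed by $\mathcal W_\ell$ and the dual variable $\tilde{\boldsymbol\zeta}_\ell$ by $\mathcal W_\ell\setminus\tilde{\mathcal W}_\ell$. Then $(\tilde\Delta\boldsymbol x,\tilde\Delta\boldsymbol\lambda)$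 is defined nodewise: for $k\in\mathcal V$ and the unique $\ell$ with $k\in\mathcal V_\ell$, its components at node $k$ are the components of $(\tilde{\boldsymbol\omega}^*_\ell,\tilde{\boldsymbol\zeta}^*_\ell)$ at node $k$. Assumptions. (A1) For a constant $\gamma_H\in(0,1]$ and all $\tau\ge0$, $\boldsymbol\omega^T\hat H^\tau\boldsymbol\omega\ge\gamma_H\|\boldsymbol\omega\|^2$ whenever $G^\tau\boldsymbol\omega=\boldsymbol0$. (A2) For a constant $\gamma_G\in(0,1]$ and all $\tau\ge0$, $G^\tau(G^\tau)^T\succeq\gamma_GI$. (A3) For a constant $\Upsilon\ge1$, all $\tau\ge0$ and all $i,j\in\mathcal V$, $\max\{\|\hat H^\tau_{i,j}\|,\|H^\tau_{i,j}\|,\|G^\tau_{i,j}\|\}\le\Upsilon$. (A4) There are polynomials $\mathrm{poly}_{\mathcal W},\mathrm{poly}_{\mathcal G}$ such that $d_{\mathcal G}(i,j)\le\mathrm{poly}_{\mathcal W}(b)$ for all $i,j\in\mathcal W_\ell$, $\ell\in[M]$, and $|\{j\in\mathcal V:d_{\mathcal G}(i,j)\le d\}|\le\mathrm{poly}_{\mathcal G}(d)$ for all $i\in\mathcal V$ and any integer $d$. Write $\mathrm{poly}_{\mathcal G\circ\mathcal W}(b):=\mathrm{poly}_{\mathcal G}(\mathrm{poly}_{\mathcal W}(b))$, so $|\mathcal W_\ell|\le\mathrm{poly}_{\mathcal G\circ\mathcal W}(b)$. Constants: $\hat\Upsilon:=\Upsilon\cdot\mathrm{poly}_{\mathcal G}(1)^2$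 (which bounds $\|\hat H^\tau\|,\|H^\tau\|,\|G^\tau\|$ for all $\tau$), $\hat\mu:=4\hat\Upsilon^2/(\gamma_G\gamma_H)$, $\Upsilon_K=1.5\mu\hat\Upsilon^2$, $\gamma_K=\gamma_H^3\gamma_G^2/(75\Upsilon_K^6)$, $\rho_\mu=\big((\Upsilon_K^2-\gamma_K^2)/(\Upsilon_K^2+\gamma_K^2)\big)^{1/4}\in(0,1)$, $\Upsilon_\mu=\Upsilon_K/(\gamma_K^2\rho_\mu^2)$.
   Formalization: In (A4) the ball bound is also assumed at radius d = poly_W(b), which need not be an integer; without this poly_G(poly_W(b)) could be negative and the bound false. It is automatic if poly_W(b) is an integer or poly_G is nondecreasing on [0,∞). *)

theory Defs
  imports "HOL-Analysis.Analysis" "HOL-Computational_Algebra.Polynomial"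
begin

text \<open>
  An undirected graph is a finite node set \<open>V\<close> with a symmetric relation \<open>E \<subseteq> V \<times> V\<close>. The relational
  power \<open>E ^^ n\<close> relates the endpoints of walks with \<open>n\<close> edges, and a shortest walk is a
  shortest path; the distance between nodes in different components is \<open>\<infinity>\<close>.
\<close>

definition undirected_graph :: "'v set \<Rightarrow> ('v \<times> 'v) set \<Rightarrow> bool" where
  "undirected_graph V E \<longleftrightarrow> finite V \<and> E \<subseteq> V \<times> V \<and> sym E"

definition gdist :: "('v \<times> 'v) set \<Rightarrow> 'v \<Rightarrow> 'v \<Rightarrow> enat" where
  "gdist E i j = (INF n \<in> {n. (i, j) \<in> E ^^ n}. enat n)"

definition gdist_set :: "('v \<times> 'v) set \<Rightarrow> 'v \<Rightarrow> 'v set \<Rightarrow> enat" where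
  "gdist_set E i W = (INF j \<in> W. gdist E i j)"

definition closed_nbhd :: "'v set \<Rightarrow> ('v \<times> 'v) set \<Rightarrow> nat \<Rightarrow> 'v set \<Rightarrow> 'v set" where
  "closed_nbhd V E b W = {i \<in> V. gdist_set E i W \<le> enat b}"

definition open_nbhd :: "'v set \<Rightarrow> ('v \<times> 'v) set \<Rightarrow> 'v set \<Rightarrow> 'v set" where
  "open_nbhd V E W = closed_nbhd V E 1 W - W"

text \<open>
  The scalar coordinates of a node-indexed vector form a finite type, and an owner map \<open>nd\<close> sends
  each coordinate to its node, so the block at node \<open>i\<close> has dimension \<open>card {p. nd p = i}\<close>, which
  may depend on \<open>i\<close> and may be \<open>0\<close>. A vector indexed by a node set \<open>I\<close> is represented by its
  extension by zero to all coordinates; likewise for matrices. Euclidean and spectral norms are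
  unchanged by this extension.

  The full problem uses \<open>I = V\<close>. Coordinates owned by an element outside \<open>V\<close> do not belong to the
  problem; allowing them permits problems with no constraints at all, although
  the coordinate types themselves are nonempty.
\<close>

definition indexed_by :: "('n \<Rightarrow> 'v) \<Rightarrow> 'v set \<Rightarrow> real ^ 'n \<Rightarrow> bool" where
  "indexed_by nd I v \<longleftrightarrow> (\<forall>p. nd p \<notin> I \<longrightarrow> v $ p = 0)"

definition subvec :: "('n \<Rightarrow> 'v) \<Rightarrow> real ^ 'n \<Rightarrow> 'v set \<Rightarrow> real ^ 'n" where
  "subvec nd v I = (\<chi> p. if nd p \<in> I then v $ p else 0)"

definition submat ::
  "('m \<Rightarrow> 'v) \<Rightarrow> ('n \<Rightarrow> 'v) \<Rightarrow> real ^ 'n ^ 'm \<Rightarrow> 'v set \<Rightarrow> 'v set \<Rightarrow> real ^ 'n ^ 'm" where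
  "submat rd cd A I J = (\<chi> p q. if rd p \<in> I \<and> cd q \<in> J then A $ p $ q else 0)"

abbreviation block ::
  "('m \<Rightarrow> 'v) \<Rightarrow> ('n \<Rightarrow> 'v) \<Rightarrow> real ^ 'n ^ 'm \<Rightarrow> 'v \<Rightarrow> 'v \<Rightarrow> real ^ 'n ^ 'm" where
  "block rd cd A i j \<equiv> submat rd cd A {i} {j}"

definition spectral_norm :: "real ^ 'n ^ 'm \<Rightarrow> real" where
  "spectral_norm A = onorm ((*v) A)"

definition twice_continuously_differentiable ::
  "('a::real_normed_vector \<Rightarrow> 'b::real_normed_vector) \<Rightarrow> bool" where
  "twice_continuously_differentiable \<phi> \<longleftrightarrow>
     (\<exists>(\<phi>' :: 'a \<Rightarrow> 'a \<Rightarrow>\<^sub>L 'b) (\<phi>'' :: 'a \<Rightarrow> 'a \<Rightarrow>\<^sub>L 'a \<Rightarrow>\<^sub>L 'b).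
        (\<forall>x. (\<phi> has_derivative blinfun_apply (\<phi>' x)) (at x)) \<and>
        (\<forall>x. (\<phi>' has_derivative blinfun_apply (\<phi>'' x)) (at x)) \<and>
        continuous_on UNIV \<phi>'')"

definition gradient :: "(real ^ 'n \<Rightarrow> real) \<Rightarrow> real ^ 'n \<Rightarrow> real ^ 'n" where
  "gradient \<phi> x = (\<chi> p. frechet_derivative \<phi> (at x) (axis p 1))"

definition hessian :: "(real ^ 'n \<Rightarrow> real) \<Rightarrow> real ^ 'n \<Rightarrow> real ^ 'n ^ 'n" where
  "hessian \<phi> x = jacobian (gradient \<phi>) (at x)"

text \<open>
  The function \<open>c\<close> is the stacked constraint: \<open>c\<^sub>i\<close> consists of the components of \<open>c\<close> owned by node
  \<open>i\<close> under \<open>dn\<close>. Both \<open>f i\<close> and \<open>c\<^sub>i\<close> read only the blocks \<open>x\<^sub>j\<close> with \<open>j\<close> in the closed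
  neighbourhood of \<open>i\<close>.
\<close>

definition graph_nlp ::
  "'v set \<Rightarrow> ('v \<times> 'v) set \<Rightarrow> ('p \<Rightarrow> 'v) \<Rightarrow> ('d \<Rightarrow> 'v) \<Rightarrow>
   ('v \<Rightarrow> real ^ 'p \<Rightarrow> real) \<Rightarrow> (real ^ 'p \<Rightarrow> real ^ 'd) \<Rightarrow> bool" where
  "graph_nlp V E pn dn f c \<longleftrightarrow>
     undirected_graph V E \<and>
     (\<forall>i\<in>V. twice_continuously_differentiable (f i)) \<and>
     twice_continuously_differentiable c \<and>
     (\<forall>i\<in>V. \<forall>x y. (\<forall>p. pn p \<in> closed_nbhd V E 1 {i} \<longrightarrow> x $ p = y $ p) \<longrightarrow> f i x = f i y) \<and>
     (\<forall>d. dn d \<in> V \<longrightarrow>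
        (\<forall>x y. (\<forall>p. pn p \<in> closed_nbhd V E 1 {dn d} \<longrightarrow> x $ p = y $ p) \<longrightarrow> c x $ d = c y $ d)) \<and>
     (\<forall>x. indexed_by dn V (c x))"

definition lagrangian ::
  "'v set \<Rightarrow> ('v \<Rightarrow> real ^ 'p \<Rightarrow> real) \<Rightarrow> (real ^ 'p \<Rightarrow> real ^ 'd) \<Rightarrow> real ^ 'p \<Rightarrow> real ^ 'd \<Rightarrow> real" where
  "lagrangian V f c x l = (\<Sum>i\<in>V. f i x) + l \<bullet> c x"

definition structured_hessian ::
  "'v set \<Rightarrow> ('v \<times> 'v) set \<Rightarrow> ('p \<Rightarrow> 'v) \<Rightarrow> real ^ 'p ^ 'p \<Rightarrow> bool" where
  "structured_hessian V E pn A \<longleftrightarrow>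
     transpose A = A \<and>
     (\<forall>i j. i \<notin> V \<or> j \<notin> V \<or> gdist E i j > 2 \<longrightarrow> block pn pn A i j = 0)"

definition newton_direction ::
  "'v set \<Rightarrow> ('p \<Rightarrow> 'v) \<Rightarrow> ('d \<Rightarrow> 'v) \<Rightarrow> real ^ 'p ^ 'p \<Rightarrow> real ^ 'p ^ 'd \<Rightarrow>
   real ^ 'p \<Rightarrow> real ^ 'd \<Rightarrow> real ^ 'p \<Rightarrow> real ^ 'd \<Rightarrow> bool" where
  "newton_direction V pn dn Hh G gx gl \<Delta>x \<Delta>l \<longleftrightarrow>
     indexed_by pn V \<Delta>x \<and> indexed_by dn V \<Delta>l \<and>
     Hh *v \<Delta>x + transpose G *v \<Delta>l = - gx \<and>
     G *v \<Delta>x = - gl"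

text \<open>The families \<open>Vs\<close> and \<open>Ws\<close> are indexed by \<open>{1..M}\<close>; empty parts are not excluded.\<close>

definition overlapping_decomposition ::
  "'v set \<Rightarrow> ('v \<times> 'v) set \<Rightarrow> nat \<Rightarrow> nat \<Rightarrow> (nat \<Rightarrow> 'v set) \<Rightarrow> (nat \<Rightarrow> 'v set) \<Rightarrow> bool" where
  "overlapping_decomposition V E b M Vs Ws \<longleftrightarrow>
     disjoint_family_on Vs {1..M} \<and> (\<Union>l\<in>{1..M}. Vs l) = V \<and> b \<ge> 1 \<and>
     (\<forall>l\<in>{1..M}. closed_nbhd V E b (Vs l) \<subseteq> Ws l \<and> Ws l \<subseteq> V)"

definition W_tilde :: "'v set \<Rightarrow> ('v \<times> 'v) set \<Rightarrow> 'v set \<Rightarrow> 'v set" where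
  "W_tilde V E W = open_nbhd V E (open_nbhd V E W) \<inter> W"

definition W_hat :: "'v set \<Rightarrow> ('v \<times> 'v) set \<Rightarrow> 'v set \<Rightarrow> 'v set" where
  "W_hat V E W = open_nbhd V E W \<union> W_tilde V E W"

definition subproblem_objective ::
  "'v set \<Rightarrow> ('v \<times> 'v) set \<Rightarrow> ('p \<Rightarrow> 'v) \<Rightarrow> ('d \<Rightarrow> 'v) \<Rightarrow> real ^ 'p ^ 'p \<Rightarrow> real ^ 'p ^ 'd \<Rightarrow>
   real ^ 'p \<Rightarrow> real ^ 'd \<Rightarrow> real \<Rightarrow> 'v set \<Rightarrow> real ^ 'p \<Rightarrow> real" where
  "subproblem_objective V E pn dn Hh G gx cx \<mu> W \<omega> =
     1/2 * (\<omega> \<bullet> (submat pn pn Hh W W *v \<omega>)) + \<omega> \<bullet> subvec pn gx W +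
     \<mu>/2 * (norm (subvec dn cx (W_hat V E W) + submat dn pn G (W_hat V E W) W *v \<omega>))\<^sup>2"

definition subproblem_constraint ::
  "'v set \<Rightarrow> ('v \<times> 'v) set \<Rightarrow> ('p \<Rightarrow> 'v) \<Rightarrow> ('d \<Rightarrow> 'v) \<Rightarrow> real ^ 'p ^ 'd \<Rightarrow>
   real ^ 'd \<Rightarrow> 'v set \<Rightarrow> real ^ 'p \<Rightarrow> real ^ 'd" where
  "subproblem_constraint V E pn dn G cx W \<omega> =
     subvec dn cx (W - W_tilde V E W) + submat dn pn G (W - W_tilde V E W) W *v \<omega>"

text \<open>
  A primal-dual solution is a constrained minimizer together with a Lagrange multiplier making the
  Lagrangian of the subproblem stationary at it. Objective and constraint do not depend on the
  coordinates outside \<open>W\<close>, so the derivative may be taken in the full coordinate space.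
\<close>

definition subproblem_solution ::
  "'v set \<Rightarrow> ('v \<times> 'v) set \<Rightarrow> ('p \<Rightarrow> 'v) \<Rightarrow> ('d \<Rightarrow> 'v) \<Rightarrow> real ^ 'p ^ 'p \<Rightarrow> real ^ 'p ^ 'd \<Rightarrow>
   real ^ 'p \<Rightarrow> real ^ 'd \<Rightarrow> real \<Rightarrow> 'v set \<Rightarrow> real ^ 'p \<Rightarrow> real ^ 'd \<Rightarrow> bool" where
  "subproblem_solution V E pn dn Hh G gx cx \<mu> W \<omega> \<zeta> \<longleftrightarrow>
     is_arg_min (subproblem_objective V E pn dn Hh G gx cx \<mu> W)
       (\<lambda>w. indexed_by pn W w \<and> subproblem_constraint V E pn dn G cx W w = 0) \<omega> \<and>
     indexed_by dn (W - W_tilde V E W) \<zeta> \<and>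
     ((\<lambda>w. subproblem_objective V E pn dn Hh G gx cx \<mu> W w
            + \<zeta> \<bullet> subproblem_constraint V E pn dn G cx W w) has_derivative (\<lambda>_. 0)) (at \<omega>)"

definition assemble ::
  "'v set \<Rightarrow> ('n \<Rightarrow> 'v) \<Rightarrow> nat \<Rightarrow> (nat \<Rightarrow> 'v set) \<Rightarrow> (nat \<Rightarrow> real ^ 'n) \<Rightarrow> real ^ 'n" where
  "assemble V nd M Vs w =
     (\<chi> p. if nd p \<in> V then w (THE l. l \<in> {1..M} \<and> nd p \<in> Vs l) $ p else 0)"

definition reduced_hessian_bound ::
  "'v set \<Rightarrow> ('p \<Rightarrow> 'v) \<Rightarrow> real \<Rightarrow> (nat \<Rightarrow> real ^ 'p ^ 'p) \<Rightarrow> (nat \<Rightarrow> real ^ 'p ^ 'd) \<Rightarrow> bool" where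
  "reduced_hessian_bound V pn \<gamma>H Hh G \<longleftrightarrow> 0 < \<gamma>H \<and> \<gamma>H \<le> 1 \<and>
     (\<forall>t \<omega>. indexed_by pn V \<omega> \<and> G t *v \<omega> = 0 \<longrightarrow> \<omega> \<bullet> (Hh t *v \<omega>) \<ge> \<gamma>H * (norm \<omega>)\<^sup>2)"

definition uniform_licq :: "'v set \<Rightarrow> ('d \<Rightarrow> 'v) \<Rightarrow> real \<Rightarrow> (nat \<Rightarrow> real ^ 'p ^ 'd) \<Rightarrow> bool" where
  "uniform_licq V dn \<gamma>G G \<longleftrightarrow> 0 < \<gamma>G \<and> \<gamma>G \<le> 1 \<and>
     (\<forall>t l. indexed_by dn V l \<longrightarrow> l \<bullet> ((G t ** transpose (G t)) *v l) \<ge> \<gamma>G * (norm l)\<^sup>2)"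

definition block_bound ::
  "'v set \<Rightarrow> ('p \<Rightarrow> 'v) \<Rightarrow> ('d \<Rightarrow> 'v) \<Rightarrow> real \<Rightarrow> (nat \<Rightarrow> real ^ 'p ^ 'p) \<Rightarrow>
   (nat \<Rightarrow> real ^ 'p ^ 'p) \<Rightarrow> (nat \<Rightarrow> real ^ 'p ^ 'd) \<Rightarrow> bool" where
  "block_bound V pn dn \<Upsilon> Hh H G \<longleftrightarrow> \<Upsilon> \<ge> 1 \<and>
     (\<forall>t. \<forall>i\<in>V. \<forall>j\<in>V.
        spectral_norm (block pn pn (Hh t) i j) \<le> \<Upsilon> \<and>
        spectral_norm (block pn pn (H t) i j) \<le> \<Upsilon> \<and>
        spectral_norm (block dn pn (G t) i j) \<le> \<Upsilon>)"

text \<open>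
  The ball bound is required at nonnegative integer radii and at the radius \<open>d = poly pW b\<close>, where it
  gives \<open>card (Ws l) \<le> poly pG (poly pW b)\<close>. The second case is redundant if \<open>poly pW b\<close> is an
  integer or \<open>pG\<close> is nondecreasing on the nonnegative reals, but does not follow from the first for
  arbitrary real polynomials.
\<close>

definition polynomial_growth ::
  "'v set \<Rightarrow> ('v \<times> 'v) set \<Rightarrow> nat \<Rightarrow> nat \<Rightarrow> (nat \<Rightarrow> 'v set) \<Rightarrow> real poly \<Rightarrow> real poly \<Rightarrow> bool" where
  "polynomial_growth V E b M Ws pW pG \<longleftrightarrow>
     (\<forall>l\<in>{1..M}. \<forall>i\<in>Ws l. \<forall>j\<in>Ws l. ereal_of_enat (gdist E i j) \<le> ereal (poly pW (real b))) \<and>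
     (\<forall>i\<in>V. \<forall>d::real. d \<in> \<nat> \<or> d = poly pW (real b) \<longrightarrow>
        real (card {j\<in>V. ereal_of_enat (gdist E i j) \<le> ereal d}) \<le> poly pG d)"

definition Ups_hat :: "real \<Rightarrow> real poly \<Rightarrow> real" where
  "Ups_hat \<Upsilon> pG = \<Upsilon> * (poly pG 1)\<^sup>2"

definition mu_hat :: "real \<Rightarrow> real \<Rightarrow> real \<Rightarrow> real poly \<Rightarrow> real" where
  "mu_hat \<gamma>H \<gamma>G \<Upsilon> pG = 4 * (Ups_hat \<Upsilon> pG)\<^sup>2 / (\<gamma>G * \<gamma>H)"

definition Ups_K :: "real \<Rightarrow> real \<Rightarrow> real poly \<Rightarrow> real" where
  "Ups_K \<mu> \<Upsilon> pG = 3/2 * \<mu> * (Ups_hat \<Upsilon> pG)\<^sup>2"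

definition gamma_K :: "real \<Rightarrow> real \<Rightarrow> real \<Rightarrow> real \<Rightarrow> real poly \<Rightarrow> real" where
  "gamma_K \<mu> \<gamma>H \<gamma>G \<Upsilon> pG = \<gamma>H ^ 3 * \<gamma>G ^ 2 / (75 * Ups_K \<mu> \<Upsilon> pG ^ 6)"

definition rho :: "real \<Rightarrow> real \<Rightarrow> real \<Rightarrow> real \<Rightarrow> real poly \<Rightarrow> real" where
  "rho \<mu> \<gamma>H \<gamma>G \<Upsilon> pG =
     (((Ups_K \<mu> \<Upsilon> pG)\<^sup>2 - (gamma_K \<mu> \<gamma>H \<gamma>G \<Upsilon> pG)\<^sup>2) /
      ((Ups_K \<mu> \<Upsilon> pG)\<^sup>2 + (gamma_K \<mu> \<gamma>H \<gamma>G \<Upsilon> pG)\<^sup>2)) powr (1/4)"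

definition Ups_mu :: "real \<Rightarrow> real \<Rightarrow> real \<Rightarrow> real \<Rightarrow> real poly \<Rightarrow> real" where
  "Ups_mu \<mu> \<gamma>H \<gamma>G \<Upsilon> pG =
     Ups_K \<mu> \<Upsilon> pG / ((gamma_K \<mu> \<gamma>H \<gamma>G \<Upsilon> pG)\<^sup>2 * (rho \<mu> \<gamma>H \<gamma>G \<Upsilon> pG)\<^sup>2)"

definition Ups_mu_b ::
  "real \<Rightarrow> nat \<Rightarrow> real \<Rightarrow> real \<Rightarrow> real \<Rightarrow> real poly \<Rightarrow> real poly \<Rightarrow> real" where
  "Ups_mu_b \<mu> b \<gamma>H \<gamma>G \<Upsilon> pW pG =
     sqrt 2 * Ups_mu \<mu> \<gamma>H \<gamma>G \<Upsilon> pG * Ups_K \<mu> \<Upsilon> pG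
       / (rho \<mu> \<gamma>H \<gamma>G \<Upsilon> pG * sqrt (1 - (rho \<mu> \<gamma>H \<gamma>G \<Upsilon> pG)\<^sup>2))
     * (poly pG (poly pW (real b)) * sqrt (poly pG (real b + 2)))"

end

theory Submission
  imports Defs
begin

text \<open>
  Restricted to \<open>Ws l\<close>, the exact Newton direction solves the KKT system of the \<open>l\<close>-th subproblem up to a
  residual supported within distance two of the complement of \<open>Ws l\<close>, hence at distance at least
  \<open>b - 1\<close> from \<open>Vs l\<close>. The KKT operator \<open>K\<close> of the subproblem is self-adjoint, couples only nodes
  at distance at most two, and its singular values lie between \<open>gamma_K\<close> and \<open>Ups_K\<close>: the augmented form
  \<open>Hh + \<mu> G\<^sup>T G\<close> is coercive, and on the kernel of the remaining constraints the penalty on \<open>W_hat\<close> equals the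
  full one. Therefore \<open>T = I - 2 / (Ups_K\<^sup>2 + gamma_K\<^sup>2) K\<^sup>2\<close> contracts by \<open>rho ^ 4\<close>. The error \<open>e\<close> and \<open>T\<^sup>k e\<close> agree on
  \<open>Vs l\<close> as long as the \<open>k\<close> Richardson steps cannot carry the residual to \<open>Vs l\<close>, i.e. for \<open>4 k \<le> b\<close>, which yields
  the factor \<open>rho ^ b\<close> up to \<open>rho ^ 3\<close>. Summing the squared local errors, a node is counted once for
  each \<open>Ws l\<close> within distance two of it, and polynomial growth bounds their number.
\<close>

section \<open>Linear algebra of saddle point operators\<close>

text \<open>With \<open>y\<close> the multiple of \<open>T x\<close> that has the length of
  \<open>x\<close>, polarization writes \<open>T x \<bullet> y\<close> through two values of the
  quadratic form, and the parallelogram law adds up their bounds. This stands in for a spectral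
  decomposition of \<open>T\<close>.\<close>

lemma self_adjoint_norm_le:
  fixes T :: "'a::real_inner \<Rightarrow> 'a"
  assumes T: "linear T" "subspace S" "\<And>x. x \<in> S \<Longrightarrow> T x \<in> S"
    and adj: "\<And>x y. T x \<bullet> y = x \<bullet> T y"
    and form: "\<And>x. x \<in> S \<Longrightarrow> \<bar>x \<bullet> T x\<bar> \<le> \<theta> * (norm x)\<^sup>2"
    and x: "x \<in> S"
  shows "norm (T x) \<le> \<theta> * norm x"
proof (cases "T x = 0 \<or> x = 0")
  case True
  have "0 \<le> \<theta> * norm x"
  proof (cases "x = 0")
    case False
    have "0 \<le> \<theta> * (norm x)\<^sup>2" using form[OF x] by linarith
    then show ?thesis using False by (simp add: zero_le_mult_iff)
  qed simp
  then show ?thesis using True linear_0[OF T(1)] by auto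
next
  case False
  define y where "y = (norm x / norm (T x)) *\<^sub>R T x"
  have yS: "y \<in> S" unfolding y_def using T x by (simp add: subspace_scale)
  have ny: "norm y = norm x" using False by (simp add: y_def)
  have "4 * (T x \<bullet> y) = (x + y) \<bullet> T (x + y) - (x - y) \<bullet> T (x - y)"
    using adj[of x y] adj[of y x]
    by (simp add: linear_add[OF T(1)] linear_diff[OF T(1)] algebra_simps inner_commute)
  also have "\<dots> \<le> \<theta> * (norm (x + y))\<^sup>2 + \<theta> * (norm (x - y))\<^sup>2"
    using form[of "x + y"] form[of "x - y"] x yS T(2)
    by (simp add: subspace_add subspace_diff abs_le_iff)
  also have "\<dots> = 4 * \<theta> * (norm x)\<^sup>2"
    using ny by (simp add: power2_norm_eq_inner algebra_simps inner_commute norm_eq)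
  finally have "norm x * norm (T x) \<le> \<theta> * (norm x)\<^sup>2"
    using False by (simp add: y_def power2_norm_eq_inner[symmetric] power2_eq_square)
  then show ?thesis using False by (simp add: power2_eq_square)
qed

text \<open>The quadratic form of \<open>K\<close> squared lies between \<gamma> squared and
  \<Upsilon> squared. The step length is the one that sends these two extremes to opposite values,
  so both give the same contraction factor.\<close>

lemma richardson_contraction:
  fixes K :: "'a::real_inner \<Rightarrow> 'a"
  assumes K: "linear K" "subspace S" "\<And>x. x \<in> S \<Longrightarrow> K x \<in> S"
    and adj: "\<And>x y. K x \<bullet> y = x \<bullet> K y"
    and lower: "\<And>x. x \<in> S \<Longrightarrow> \<gamma> * norm x \<le> norm (K x)"
    and upper: "\<And>x. x \<in> S \<Longrightarrow> norm (K x) \<le> \<Upsilon> * norm x"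
    and pos: "0 < \<gamma>" and x: "x \<in> S"
  shows "norm (x - (2 / (\<Upsilon>\<^sup>2 + \<gamma>\<^sup>2)) *\<^sub>R K (K x)) \<le> (\<Upsilon>\<^sup>2 - \<gamma>\<^sup>2) / (\<Upsilon>\<^sup>2 + \<gamma>\<^sup>2) * norm x"
proof -
  define c where "c = 2 / (\<Upsilon>\<^sup>2 + \<gamma>\<^sup>2)"
  define T where "T = (\<lambda>x. x - c *\<^sub>R K (K x))"
  have d: "\<Upsilon>\<^sup>2 + \<gamma>\<^sup>2 > 0" using pos by (simp add: add_nonneg_pos)
  then have c: "(\<Upsilon>\<^sup>2 + \<gamma>\<^sup>2) * c = 2"
    unfolding c_def by (metis less_irrefl nonzero_mult_div_cancel_left times_divide_eq_right)
  have lin: "linear T"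
    unfolding T_def using K(1)
    by (auto intro!: linearI simp: linear_add linear_scale algebra_simps)
  have "norm (T x) \<le> (\<Upsilon>\<^sup>2 - \<gamma>\<^sup>2) / (\<Upsilon>\<^sup>2 + \<gamma>\<^sup>2) * norm x"
  proof (rule self_adjoint_norm_le[OF lin K(2) _ _ _ x])
    show "T x \<in> S" if "x \<in> S" for x
      using that K by (simp add: T_def subspace_diff subspace_scale)
    show "T x \<bullet> y = x \<bullet> T y" for x y
      by (simp add: T_def inner_diff_left inner_diff_right adj)
    show "\<bar>x \<bullet> T x\<bar> \<le> (\<Upsilon>\<^sup>2 - \<gamma>\<^sup>2) / (\<Upsilon>\<^sup>2 + \<gamma>\<^sup>2) * (norm x)\<^sup>2" if "x \<in> S" for x
    proof -
      have eq: "x \<bullet> T x = (norm x)\<^sup>2 - c * (norm (K x))\<^sup>2"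
        by (simp add: T_def inner_diff_right adj[symmetric] power2_norm_eq_inner)
      have l: "\<gamma>\<^sup>2 * (norm x)\<^sup>2 \<le> (norm (K x))\<^sup>2"
        using power_mono[OF lower[OF that], of 2] pos by (simp add: power_mult_distrib)
      have u: "(norm (K x))\<^sup>2 \<le> \<Upsilon>\<^sup>2 * (norm x)\<^sup>2"
        using power_mono[OF upper[OF that], of 2] by (simp add: power_mult_distrib)
      have "(\<Upsilon>\<^sup>2 + \<gamma>\<^sup>2) * (x \<bullet> T x) = (\<Upsilon>\<^sup>2 + \<gamma>\<^sup>2) * (norm x)\<^sup>2 - 2 * (norm (K x))\<^sup>2"
        using c unfolding eq by (simp add: right_diff_distrib mult.assoc[symmetric])
      then have "\<bar>(\<Upsilon>\<^sup>2 + \<gamma>\<^sup>2) * (x \<bullet> T x)\<bar> \<le> (\<Upsilon>\<^sup>2 - \<gamma>\<^sup>2) * (norm x)\<^sup>2"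
        using l u by (simp add: abs_le_iff algebra_simps)
      then show ?thesis using d by (simp add: abs_mult field_simps)
    qed
  qed
  then show ?thesis by (simp add: T_def c_def)
qed

text \<open>
  The difference between \<open>e\<close> and \<open>T\<^sup>k e\<close>, where \<open>T\<close> is the contraction above, is a combination of
  \<open>T\<^sup>j K (K e)\<close> with \<open>j < k\<close>, hence it is killed by \<open>Q\<close> as long as \<open>4 * k \<le> D + 1\<close>.
\<close>

lemma banded_solution_decay:
  fixes K :: "'a::real_inner \<Rightarrow> 'a" and Q :: "'a \<Rightarrow> 'b::real_normed_vector"
  assumes K: "linear K" "subspace S" "\<And>x. x \<in> S \<Longrightarrow> K x \<in> S"
    and adj: "\<And>x y. K x \<bullet> y = x \<bullet> K y"
    and lower: "\<And>x. x \<in> S \<Longrightarrow> \<gamma> * norm x \<le> norm (K x)"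
    and upper: "\<And>x. x \<in> S \<Longrightarrow> norm (K x) \<le> \<Upsilon> * norm x"
    and pos: "0 < \<gamma>" "\<gamma> \<le> \<Upsilon>"
    and F: "\<And>n. subspace (F n)" "antimono F"
    and band: "\<And>n x. x \<in> F (n + 2) \<Longrightarrow> K x \<in> F n"
    and Q: "linear Q" "\<And>x. norm (Q x) \<le> norm x" "\<And>x. x \<in> F 1 \<Longrightarrow> Q x = 0"
    and e: "e \<in> S" "K e \<in> F D" and k: "4 * k \<le> D + 1"
  shows "norm (Q e) \<le> ((\<Upsilon>\<^sup>2 - \<gamma>\<^sup>2) / (\<Upsilon>\<^sup>2 + \<gamma>\<^sup>2)) ^ k / \<gamma> * norm (K e)"
proof -
  define c where "c = 2 / (\<Upsilon>\<^sup>2 + \<gamma>\<^sup>2)"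
  define T where "T = (\<lambda>x. x - c *\<^sub>R K (K x))"
  define \<theta> where "\<theta> = (\<Upsilon>\<^sup>2 - \<gamma>\<^sup>2) / (\<Upsilon>\<^sup>2 + \<gamma>\<^sup>2)"
  have \<theta>: "0 \<le> \<theta>" unfolding \<theta>_def using pos by (auto intro!: divide_nonneg_nonneg power_mono)
  have lin: "linear T"
    unfolding T_def using K(1)
    by (auto intro!: linearI simp: linear_add linear_scale algebra_simps)
  have TS: "T x \<in> S" if "x \<in> S" for x
    using that K by (simp add: T_def subspace_diff subspace_scale)
  have Tpow: "(T ^^ k) e \<in> S \<and> norm ((T ^^ k) e) \<le> \<theta> ^ k * norm e" for k
  proof (induction k)
    case (Suc k)
    have "norm (T ((T ^^ k) e)) \<le> \<theta> * norm ((T ^^ k) e)"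
      using richardson_contraction[OF K adj lower upper pos(1), of "(T ^^ k) e"] Suc
      by (simp add: T_def c_def \<theta>_def)
    also have "\<dots> \<le> \<theta> * (\<theta> ^ k * norm e)" using Suc \<theta> by (intro mult_left_mono) auto
    finally show ?case using Suc TS by (simp add: mult.assoc)
  qed (use e in simp)
  have mono: "x \<in> F m" if "x \<in> F n" "m \<le> n" for x m n
    using F(2) that by (auto simp: monotone_def)
  have TF: "T x \<in> F m" if "x \<in> F (m + 4)" for x m
  proof -
    have "K (K x) \<in> F m" using that band[of "K x" m] band[of x "m + 2"] by (simp add: numeral_eq_Suc)
    then show ?thesis
      using F(1) mono[OF that, of m] by (simp add: T_def subspace_diff subspace_scale)
  qed
  \<comment> \<open>Each application of \<open>T\<close> costs four levels of the filtration. The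
    innermost term \<open>K (K e)\<close> costs only two, because \<open>K e\<close> is already
    known to lie in \<open>F D\<close>; this is the 2 in \<open>D + 2\<close>.\<close>
  have "e - (T ^^ k) e \<in> F m" if "4 * k + m \<le> D + 2" for k m
    using that
  proof (induction k arbitrary: m)
    case 0
    then show ?case using F(1) by (simp add: subspace_0)
  next
    case (Suc k)
    have "K e \<in> F (m + 2)" using mono[OF e(2)] Suc.prems by simp
    then have "e - T e \<in> F m" using band F(1) by (simp add: T_def subspace_scale)
    moreover have "T (e - (T ^^ k) e) \<in> F m" using Suc by (intro TF Suc.IH) simp
    ultimately have "(e - T e) + (T e - T ((T ^^ k) e)) \<in> F m"
      using F(1) lin by (simp only: linear_diff subspace_add)
    then show ?case by simp
  qed
  from this[of k 1] k have "Q (e - (T ^^ k) e) = 0" using Q(3) by simp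
  then have "norm (Q e) = norm (Q ((T ^^ k) e))" using linear_diff[OF Q(1)] by simp
  also have "\<dots> \<le> \<theta> ^ k * norm e" using Q(2) Tpow order_trans by blast
  also have "\<dots> \<le> \<theta> ^ k * (norm (K e) / \<gamma>)"
    using \<theta> lower[OF e(1)] pos by (intro mult_left_mono) (auto simp: field_simps)
  finally show ?thesis by (simp add: \<theta>_def)
qed

section \<open>Kernel and row space estimates for saddle point operators\<close>

text \<open>Coercivity makes \<open>T\<close> injective on \<open>S\<close>, and comparing
  dimensions makes it onto.\<close>

lemma coercive_onto_subspace:
  fixes T :: "'a::euclidean_space \<Rightarrow> 'a"
  assumes T: "linear T" "subspace S" "\<And>x. x \<in> S \<Longrightarrow> T x \<in> S"
    and coercive: "\<And>x. x \<in> S \<Longrightarrow> g * (norm x)\<^sup>2 \<le> x \<bullet> T x" and g: "0 < g"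
    and y: "y \<in> S"
  obtains x where "x \<in> S" "T x = y"
proof -
  have zero: "x = 0" if "x \<in> S" "T x = 0" for x
  proof -
    have "g * (norm x)\<^sup>2 \<le> 0" using coercive[OF that(1)] that(2) by simp
    then show "x = 0" using g by (simp add: mult_le_0_iff)
  qed
  have inj: "inj_on T S"
  proof (rule inj_onI)
    fix x y assume "x \<in> S" "y \<in> S" "T x = T y"
    then have "x - y = 0"
      using zero[of "x - y"] subspace_diff[OF T(2)] linear_diff[OF T(1)] by simp
    then show "x = y" by simp
  qed
  have "span S = S" using T(2) by (simp add: span_eq_iff)
  then have "inj_on T (span S)" using inj by (simp only:)
  then have "dim (T ` S) = dim S" by (rule dim_image_eq[OF T(1)])
  then have "T ` S = S"
    using T by (intro subspace_dim_equal linear_subspace_image) auto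
  then have "y \<in> T ` S" using y by simp
  then show thesis by (rule imageE) (rule that, auto)
qed

text \<open>Here \<open>y\<close> solves the normal equation \<open>B (Bt y) = B p\<close>, so
  \<open>n\<close> is what remains of \<open>p\<close> in the kernel of \<open>B\<close>. The row
  space part is controlled by \<open>B p\<close> because its squared norm equals
  \<open>B p \<bullet> y\<close>, and \<open>licq\<close> bounds \<open>norm y\<close> by
  \<open>norm (Bt y)\<close>.\<close>

lemma kernel_row_space_split:
  fixes B :: "'a::euclidean_space \<Rightarrow> 'b::euclidean_space"
  assumes B: "linear B" "linear Bt" and adj: "\<And>x y. B x \<bullet> y = x \<bullet> Bt y"
    and Y: "subspace Y" "\<And>x. B x \<in> Y"
    and licq: "\<And>y. y \<in> Y \<Longrightarrow> g * (norm y)\<^sup>2 \<le> (norm (Bt y))\<^sup>2" and g: "0 < g"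
  obtains n y where "y \<in> Y" "p = n + Bt y" "B n = 0" "n \<bullet> Bt y = 0"
    "(norm p)\<^sup>2 = (norm n)\<^sup>2 + (norm (Bt y))\<^sup>2" "g * (norm (Bt y))\<^sup>2 \<le> (norm (B p))\<^sup>2"
proof -
  have "linear (\<lambda>y. B (Bt y))" using linear_compose[OF B(2,1)] by (simp add: comp_def)
  then obtain y where y: "y \<in> Y" "B (Bt y) = B p"
    using coercive_onto_subspace[of "\<lambda>y. B (Bt y)" Y g "B p"] Y licq g
    by (auto simp: inner_commute[of _ "B _"] adj power2_norm_eq_inner)
  define n where "n = p - Bt y"
  have Bn: "B n = 0" using y by (simp add: n_def linear_diff[OF B(1)])
  have orth: "n \<bullet> Bt y = 0" using Bn by (simp add: adj[symmetric])
  have "(norm (Bt y))\<^sup>2 = B p \<bullet> y" by (simp add: power2_norm_eq_inner adj[symmetric] y)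
  also have "\<dots> \<le> norm (B p) * norm y" by (rule norm_cauchy_schwarz)
  finally have 1: "(norm (Bt y))\<^sup>2 \<le> norm (B p) * norm y" .
  \<comment> \<open>Squaring lets \<open>licq\<close> enter without a square root of
    \<open>g\<close>; one factor \<open>(norm (Bt y))\<^sup>2\<close> is cancelled
    afterwards.\<close>
  have "g * ((norm (Bt y))\<^sup>2)\<^sup>2 \<le> g * (norm (B p) * norm y)\<^sup>2"
    using 1 g by (intro mult_left_mono power_mono) auto
  also have "\<dots> = (norm (B p))\<^sup>2 * (g * (norm y)\<^sup>2)" by (simp add: power_mult_distrib)
  also have "\<dots> \<le> (norm (B p))\<^sup>2 * (norm (Bt y))\<^sup>2"
    using licq[OF y(1)] by (intro mult_left_mono) auto
  finally have "g * (norm (Bt y))\<^sup>2 * (norm (Bt y))\<^sup>2 \<le> (norm (B p))\<^sup>2 * (norm (Bt y))\<^sup>2"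
    by (simp add: power2_eq_square mult.assoc)
  then have 2: "g * (norm (Bt y))\<^sup>2 \<le> (norm (B p))\<^sup>2"
    by (cases "Bt y = 0") (auto dest!: mult_right_le_imp_le)
  have "(norm p)\<^sup>2 = (norm n)\<^sup>2 + (norm (Bt y))\<^sup>2"
    using orth unfolding n_def power2_norm_eq_inner by (simp add: algebra_simps inner_commute)
  then show thesis using that[of y n] y Bn orth 2 by (simp add: n_def)
qed

text \<open>After the kernel and row space split, the penalty contributes at least
  \<open>4 * U\<^sup>2 / h\<close> times the squared row space part. One half of this absorbs the
  cross term with the kernel part, the other half outweighs the possibly negative curvature on the
  row space and still leaves \<open>h / 2\<close>.\<close>

lemma augmented_form_coercive:
  fixes A :: "'a::euclidean_space \<Rightarrow> 'a" and B :: "'a \<Rightarrow> 'b::euclidean_space"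
  assumes A: "linear A" "\<And>x y. A x \<bullet> y = x \<bullet> A y" "\<And>x. norm (A x) \<le> U * norm x"
    and B: "linear B" "linear Bt" and adj: "\<And>x y. B x \<bullet> y = x \<bullet> Bt y"
    and X: "subspace X" "\<And>y. Bt y \<in> X"
    and Y: "subspace Y" "\<And>x. B x \<in> Y"
    and licq: "\<And>y. y \<in> Y \<Longrightarrow> g * (norm y)\<^sup>2 \<le> (norm (Bt y))\<^sup>2"
    and red: "\<And>x. x \<in> X \<Longrightarrow> B x = 0 \<Longrightarrow> h * (norm x)\<^sup>2 \<le> x \<bullet> A x"
    and const: "0 < g" "0 < h" "h \<le> 1" "1 \<le> U" "4 * U\<^sup>2 / (g * h) \<le> \<mu>"
    and p: "p \<in> X"
  shows "h / 2 * (norm p)\<^sup>2 \<le> p \<bullet> A p + \<mu> * (norm (B p))\<^sup>2"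
proof -
  obtain n y where y: "y \<in> Y" "p = n + Bt y" "B n = 0" "n \<bullet> Bt y = 0"
    and np: "(norm p)\<^sup>2 = (norm n)\<^sup>2 + (norm (Bt y))\<^sup>2" and gr: "g * (norm (Bt y))\<^sup>2 \<le> (norm (B p))\<^sup>2"
    by (rule kernel_row_space_split[OF B adj Y licq const(1), where p = p])
  define s where "s = norm n"
  define r where "r = norm (Bt y)"
  have nX: "n \<in> X" using y(2) p X subspace_diff[of X p "Bt y"] by simp
  have 1: "h * s\<^sup>2 \<le> n \<bullet> A n" unfolding s_def by (rule red[OF nX y(3)])
  have cs: "\<bar>u \<bullet> A v\<bar> \<le> U * (norm u * norm v)" for u v
    using Cauchy_Schwarz_ineq2[of u "A v"] mult_left_mono[OF A(3)[of v], of "norm u"]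
    by (simp add: mult.left_commute)
  have "p \<bullet> A p = n \<bullet> A n + 2 * (n \<bullet> A (Bt y)) + Bt y \<bullet> A (Bt y)"
    using A(2)[of n "Bt y"]
    by (simp add: y(2) linear_add[OF A(1)] inner_add_left inner_add_right inner_commute)
  then have 2: "p \<bullet> A p \<ge> h * s\<^sup>2 - 2 * (U * (s * r)) - U * r\<^sup>2"
    using 1 cs[of n "Bt y"] cs[of "Bt y" "Bt y"]
    by (simp add: s_def r_def power2_eq_square abs_le_iff)
  \<comment> \<open>Completing the square uses up half of the kernel curvature
    \<open>h * s\<^sup>2\<close>.\<close>
  have "0 \<le> (h * s - 2 * U * r)\<^sup>2 / (2 * h)" using const by simp
  also have "\<dots> = h / 2 * s\<^sup>2 - 2 * (U * (s * r)) + 2 * U\<^sup>2 / h * r\<^sup>2"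
    using const by (simp add: power2_eq_square field_simps)
  finally have 3: "0 \<le> h / 2 * s\<^sup>2 - 2 * (U * (s * r)) + 2 * U\<^sup>2 / h * r\<^sup>2" .
  have "4 * U\<^sup>2 / h * r\<^sup>2 = 4 * U\<^sup>2 / (g * h) * (g * r\<^sup>2)" using const by simp
  also have "\<dots> \<le> \<mu> * (norm (B p))\<^sup>2"
    using const gr by (intro mult_mono) (auto simp: r_def intro: order_trans[OF _ const(5)])
  finally have 4: "4 * U\<^sup>2 / h * r\<^sup>2 \<le> \<mu> * (norm (B p))\<^sup>2" .
  have "U * 1 \<le> U * U" using const by (intro mult_mono) auto
  then have "U + h / 2 \<le> 2 * U\<^sup>2" using const(3,4) unfolding power2_eq_square by linarith
  also have "\<dots> \<le> 2 * U\<^sup>2 / h"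
    using const by (simp add: le_divide_eq mult_left_le)
  finally have "(U + h / 2) * r\<^sup>2 \<le> 2 * U\<^sup>2 / h * r\<^sup>2" by (rule mult_right_mono) simp
  then show ?thesis using 2 3 4 np
    by (simp add: s_def[symmetric] r_def[symmetric] algebra_simps)
qed

text \<open>Let \<open>s\<close> be the norm of the residual. The row space part of \<open>p\<close>
  is bounded through \<open>B p\<close>, the kernel part by testing the first component with it, and
  \<open>q\<close> through \<open>licq\<close> applied to the difference of the first component and
  \<open>A p\<close>. The result is \<open>11 * C\<^sup>2 * s / (h * g)\<close>, which is then
  weakened to the stated constant. The modulus \<open>h / 2\<close> is the one that
  \<open>augmented_form_coercive\<close> delivers.\<close>

lemma saddle_point_lower_bound:
  fixes A :: "'a::euclidean_space \<Rightarrow> 'a" and B :: "'a \<Rightarrow> 'b::euclidean_space"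
  assumes A: "linear A" "\<And>x. norm (A x) \<le> C * norm x"
    and B: "linear B" "linear Bt" and adj: "\<And>x y. B x \<bullet> y = x \<bullet> Bt y"
    and X: "subspace X" "\<And>y. Bt y \<in> X"
    and Y: "subspace Y" "\<And>x. B x \<in> Y"
    and licq: "\<And>y. y \<in> Y \<Longrightarrow> g * (norm y)\<^sup>2 \<le> (norm (Bt y))\<^sup>2"
    and red: "\<And>x. x \<in> X \<Longrightarrow> B x = 0 \<Longrightarrow> h / 2 * (norm x)\<^sup>2 \<le> x \<bullet> A x"
    and const: "0 < g" "g \<le> 1" "0 < h" "h \<le> 1" "1 \<le> C"
    and pq: "p \<in> X" "q \<in> Y"
  shows "h ^ 3 * g ^ 2 / (75 * C ^ 6) * norm (p, q) \<le> norm (A p + Bt q, B p)"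
proof -
  define s where "s = norm (A p + Bt q, B p)"
  define k where "k = sqrt g"
  have k: "0 < k" "k \<le> 1" "k\<^sup>2 = g" using const by (auto simp: k_def)
  have kle: "u \<le> v / k" if "g * u\<^sup>2 \<le> v\<^sup>2" "0 \<le> v" for u v
  proof -
    have "(k * u)\<^sup>2 \<le> v\<^sup>2" using that k by (simp add: power_mult_distrib)
    then have "k * u \<le> v" using that(2) by (rule power2_le_imp_le)
    then show ?thesis using k by (simp add: field_simps)
  qed
  have sa: "norm (A p + Bt q) \<le> s" and sb: "norm (B p) \<le> s"
    unfolding s_def using norm_fst_le[of "A p + Bt q"] norm_snd_le[of "B p"] by auto
  have s0: "0 \<le> s" by (simp add: s_def)
  obtain n y where y: "y \<in> Y" "p = n + Bt y" "B n = 0" "n \<bullet> Bt y = 0"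
    and np: "(norm p)\<^sup>2 = (norm n)\<^sup>2 + (norm (Bt y))\<^sup>2" and gr: "g * (norm (Bt y))\<^sup>2 \<le> (norm (B p))\<^sup>2"
    by (rule kernel_row_space_split[OF B adj Y licq const(1), where p = p])
  have nX: "n \<in> X" using y(2) pq X subspace_diff[of X p "Bt y"] by simp
  have r: "norm (Bt y) \<le> s / k"
    using kle[OF gr] sb k(1) by (meson divide_right_mono less_imp_le norm_ge_zero order_trans)
  \<comment> \<open>Testing with a kernel vector removes the multiplier from the first
    component.\<close>
  have "n \<bullet> Bt q = 0" using y(3) by (simp add: adj[symmetric])
  then have "n \<bullet> A n = n \<bullet> (A p + Bt q) - n \<bullet> A (Bt y)"
    by (simp add: y(2) linear_add[OF A(1)] inner_add_right)
  also have "\<dots> \<le> norm n * s + norm n * (C * norm (Bt y))"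
    using norm_cauchy_schwarz[of n "A p + Bt q"] norm_cauchy_schwarz[of n "- A (Bt y)"]
      mult_left_mono[OF sa, of "norm n"] mult_left_mono[OF A(2)[of "Bt y"], of "norm n"]
    by simp
  finally have "norm n * (h / 2 * norm n) \<le> norm n * (s + C * norm (Bt y))"
    using red[OF nX y(3)] by (simp add: power2_eq_square algebra_simps)
  then have "h / 2 * norm n \<le> s + C * norm (Bt y)"
    using s0 const by (cases "n = 0") auto
  also have "\<dots> \<le> C * (s / k) + C * (s / k)"
  proof (rule add_mono)
    have "1 * s \<le> C * s" using const s0 by (intro mult_right_mono) auto
    also have "C * s \<le> C * (s / k)"
      using k s0 const by (intro mult_left_mono) (auto simp: le_divide_eq mult_left_le)
    finally show "s \<le> C * (s / k)" by simp
    show "C * norm (Bt y) \<le> C * (s / k)" using r const by (intro mult_left_mono) auto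
  qed
  finally have n: "norm n \<le> 4 * C * s / (h * k)" using k const by (simp add: field_simps)
  have "s / k \<le> C * s / (h * k)"
  proof -
    have "h * s \<le> C * s" using const s0 by (intro mult_right_mono) auto
    then show ?thesis using k const by (simp add: field_simps)
  qed
  then have "norm p \<le> 5 * C * s / (h * k)"
    using norm_triangle_ineq[of n "Bt y"] n r y(2) by simp
  also have "\<dots> \<le> 5 * C * s / (h * g)"
  proof (rule divide_left_mono)
    show "h * g \<le> h * k" using k const by (simp add: mult_left_mono power2_eq_square mult_left_le flip: k(3))
  qed (use const s0 k in auto)
  finally have p: "norm p \<le> 5 * C * s / (h * g)" .
  \<comment> \<open>The sharper denominator \<open>h * k\<close> is kept for the multiplier
    estimate, where another division by \<open>k = sqrt g\<close> turns it into
    \<open>h * g\<close>.\<close>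
  have p': "norm p \<le> 5 * C * s / (h * k)" by fact
  have "norm (Bt q) \<le> s + C * norm p"
    using norm_triangle_ineq4[of "A p + Bt q" "A p"] sa A(2)[of p] by simp
  also have "\<dots> \<le> s + C * (5 * C * s / (h * k))"
    using p' const by (intro add_left_mono mult_left_mono) auto
  also have "\<dots> \<le> C\<^sup>2 * s / (h * k) + C * (5 * C * s / (h * k))"
  proof -
    have "h * k \<le> 1 * 1" using const k by (intro mult_mono) auto
    moreover have "1 * 1 \<le> C * C" using const by (intro mult_mono) auto
    ultimately have "h * k * s \<le> C\<^sup>2 * s"
      using s0 by (intro mult_right_mono) (auto simp: power2_eq_square)
    then show ?thesis using const k by (simp add: field_simps)
  qed
  also have "\<dots> = 6 * C\<^sup>2 * s / (h * k)" by (simp add: power2_eq_square add_divide_distrib[symmetric])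
  finally have "norm (Bt q) / k \<le> 6 * C\<^sup>2 * s / (h * k) / k" using k by (intro divide_right_mono) auto
  moreover have "norm q \<le> norm (Bt q) / k" by (rule kle[OF licq[OF pq(2)]]) simp
  ultimately have "norm q \<le> 6 * C\<^sup>2 * s / (h * g)"
    by (simp add: power2_eq_square flip: k(3))
  moreover have "5 * C * s / (h * g) \<le> 5 * C\<^sup>2 * s / (h * g)"
    using const s0 by (intro divide_right_mono mult_right_mono) (auto simp: power2_eq_square)
  ultimately have "norm (p, q) \<le> 5 * C\<^sup>2 * s / (h * g) + 6 * C\<^sup>2 * s / (h * g)"
    using norm_Pair_le[of p q] p by linarith
  also have "\<dots> = 11 * C\<^sup>2 * s / (h * g)" by (simp add: add_divide_distrib[symmetric])
  finally have "norm (p, q) \<le> 11 * C\<^sup>2 * s / (h * g)" .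
  then have "h ^ 3 * g ^ 2 / (75 * C ^ 6) * norm (p, q)
      \<le> h ^ 3 * g ^ 2 / (75 * C ^ 6) * (11 * C\<^sup>2 * s / (h * g))"
    using const by (intro mult_left_mono) auto
  also have "\<dots> = 11 / 75 * (h\<^sup>2 * g / C ^ 4) * s"
    using const by (simp add: field_simps power2_eq_square power3_eq_cube eval_nat_numeral)
  also have "\<dots> \<le> 1 * s"
  proof (rule mult_right_mono[OF _ s0])
    have "h\<^sup>2 * g \<le> 1 * 1" using const by (intro mult_mono power_le_one) auto
    also have "\<dots> \<le> C ^ 4" using const by simp
    finally have "h\<^sup>2 * g / C ^ 4 \<le> 1" using const by (simp add: divide_le_eq)
    then show "11 / 75 * (h\<^sup>2 * g / C ^ 4) \<le> 1" by simp
  qed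
  finally show ?thesis by (simp add: s_def)
qed

section \<open>Graph distances and node-indexed vectors\<close>

text \<open>The infimum is over naturals: if every walk is longer than \<open>n\<close>, it is at
  least \<open>n + 1\<close>. Later arguments use finite bounds on distances only, so disconnected
  nodes need no separate case.\<close>

lemma gdist_le_iff: "gdist E i j \<le> enat n \<longleftrightarrow> (\<exists>m\<le>n. (i, j) \<in> E ^^ m)"
proof
  assume le: "gdist E i j \<le> enat n"
  show "\<exists>m\<le>n. (i, j) \<in> E ^^ m"
  proof (rule ccontr)
    assume "\<not> ?thesis"
    then have "enat (Suc n) \<le> gdist E i j"
      unfolding gdist_def by (intro INF_greatest) (force simp: not_less_eq_eq[symmetric])
    with le show False using order_trans by fastforce
  qed
next
  assume "\<exists>m\<le>n. (i, j) \<in> E ^^ m"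
  then obtain m where m: "m \<le> n" "(i, j) \<in> E ^^ m" by blast
  then have "gdist E i j \<le> enat m" unfolding gdist_def by (intro INF_lower) simp
  also have "\<dots> \<le> enat n" using m by simp
  finally show "gdist E i j \<le> enat n" .
qed

lemma gdist_self: "gdist E i i \<le> enat n"
  unfolding gdist_le_iff by (intro exI[of _ 0]) simp

lemma gdist_commute:
  assumes "sym E"
  shows "gdist E i j = gdist E j i"
proof -
  have "(j, i) \<in> E ^^ n" if "(i, j) \<in> E ^^ n" for i j n
    using that
  proof (induction n arbitrary: j)
    case (Suc n)
    then obtain k where "(i, k) \<in> E ^^ n" "(k, j) \<in> E" by auto
    then show ?case using Suc.IH assms by (intro relpow_Suc_I2[of j k]) (auto dest: symD)
  qed simp
  then have "(i, j) \<in> E ^^ n \<longleftrightarrow> (j, i) \<in> E ^^ n" for n by blast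
  then show ?thesis by (simp add: gdist_def)
qed

lemma gdist_triangle:
  assumes "gdist E i j \<le> enat m" "gdist E j k \<le> enat n"
  shows "gdist E i k \<le> enat (m + n)"
proof -
  obtain a c where "a \<le> m" "(i, j) \<in> E ^^ a" "c \<le> n" "(j, k) \<in> E ^^ c"
    using assms unfolding gdist_le_iff by blast
  then show ?thesis
    unfolding gdist_le_iff by (intro exI[of _ "a + c"]) (auto simp: relpow_add)
qed

lemma gdist_split:
  assumes "gdist E i k \<le> enat (m + n)"
  obtains j where "gdist E i j \<le> enat m" "gdist E j k \<le> enat n"
proof -
  obtain c where c: "c \<le> m + n" "(i, k) \<in> E ^^ c" using assms unfolding gdist_le_iff by blast
  \<comment> \<open>The walk is cut after \<open>m\<close> edges, or at its end if it is
    shorter.\<close>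
  have "c = min c m + (c - min c m)" by simp
  then have "(i, k) \<in> E ^^ min c m O E ^^ (c - min c m)" using c(2) by (metis relpow_add)
  then obtain j where "(i, j) \<in> E ^^ min c m" "(j, k) \<in> E ^^ (c - min c m)" by blast
  moreover have "min c m \<le> m" "c - min c m \<le> n" using c by auto
  ultimately show thesis using that unfolding gdist_le_iff by blast
qed

lemma mem_closed_nbhd_iff:
  "i \<in> closed_nbhd V E n W \<longleftrightarrow> i \<in> V \<and> (\<exists>j\<in>W. gdist E i j \<le> enat n)"
proof -
  have "(\<exists>j\<in>W. gdist E i j \<le> enat n)" if "gdist_set E i W \<le> enat n"
  proof (rule ccontr)
    assume "\<not> ?thesis"
    then have "enat (Suc n) \<le> gdist_set E i W"
      unfolding gdist_set_def by (intro INF_greatest) (auto simp: not_le eSuc_enat[symmetric] intro: ileI1)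
    with that show False using order_trans by fastforce
  qed
  then show ?thesis
    unfolding closed_nbhd_def gdist_set_def by (auto intro: INF_lower2)
qed

section \<open>Coordinate projections onto node sets\<close>

lemma linear_subvec: "linear (\<lambda>v. subvec nd v I)"
  by (rule linearI) (simp_all add: subvec_def vec_eq_iff)

lemmas subvec_add = linear_add[OF linear_subvec]
  and subvec_diff = linear_diff[OF linear_subvec]
  and subvec_neg = linear_neg[OF linear_subvec]
  and subvec_scale = linear_scale[OF linear_subvec]
  and subvec_zero = linear_0[OF linear_subvec]

lemma subvec_subvec: "subvec nd (subvec nd v I) J = subvec nd v (I \<inter> J)"
  by (simp add: subvec_def vec_eq_iff)

lemma subvec_idem [simp]: "subvec nd (subvec nd v I) I = subvec nd v I"
  by (simp add: subvec_subvec)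

lemma inner_subvec: "subvec nd u I \<bullet> v = u \<bullet> subvec nd v I"
  unfolding inner_vec_def by (rule sum.cong) (simp_all add: subvec_def)

lemma indexed_by_subvec [simp]: "indexed_by nd I (subvec nd v I)"
  by (simp add: indexed_by_def subvec_def)

lemma subvec_eq_iff: "subvec nd v I = v \<longleftrightarrow> indexed_by nd I v"
  by (auto simp: indexed_by_def subvec_def vec_eq_iff)

lemma indexed_by_subset: "indexed_by nd I v \<Longrightarrow> I \<subseteq> J \<Longrightarrow> indexed_by nd J v"
  by (auto simp: indexed_by_def)

lemma subspace_indexed_by: "subspace {v. indexed_by nd I v}"
  by (simp add: subspace_def indexed_by_def)

lemma norm_subvec_le: "norm (subvec nd v I) \<le> norm v"
  by (rule norm_le_componentwise_cart) (simp add: subvec_def)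

lemma norm_subvec_mono: "I \<subseteq> J \<Longrightarrow> norm (subvec nd v I) \<le> norm (subvec nd v J)"
  using norm_subvec_le[of nd "subvec nd v J" I] by (simp add: subvec_subvec Int_absorb1)

lemma norm_square_cart: "(norm (v :: real ^ 'n))\<^sup>2 = (\<Sum>p\<in>UNIV. (v $ p)\<^sup>2)"
  unfolding power2_norm_eq_inner inner_vec_def by (simp add: power2_eq_square)

text \<open>Interchanging the sums exposes the multiplicity with which a node is covered. It is one
  for the partition and bounded for the overlapping sets.\<close>

lemma sum_norm_subvec:
  fixes v :: "real ^ 'n" and nd :: "'n \<Rightarrow> 'v" and L :: "'l set"
  assumes "finite L"
  shows "(\<Sum>l\<in>L. (norm (subvec nd v (S l)))\<^sup>2) = (\<Sum>p\<in>UNIV. real (card {l\<in>L. nd p \<in> S l}) * (v $ p)\<^sup>2)"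
proof -
  have "(\<Sum>l\<in>L. (norm (subvec nd v (S l)))\<^sup>2) = (\<Sum>l\<in>L. \<Sum>p\<in>UNIV. if nd p \<in> S l then (v $ p)\<^sup>2 else 0)"
    unfolding norm_square_cart by (intro sum.cong refl) (simp add: subvec_def)
  also have "\<dots> = (\<Sum>p\<in>UNIV. \<Sum>l\<in>L. if nd p \<in> S l then (v $ p)\<^sup>2 else 0)" by (rule sum.swap)
  also have "\<dots> = (\<Sum>p\<in>UNIV. real (card {l\<in>L. nd p \<in> S l}) * (v $ p)\<^sup>2)"
    using assms by (intro sum.cong refl) (simp add: sum.inter_filter[symmetric])
  finally show ?thesis .
qed

lemma sum_norm_subvec_le:
  fixes v :: "real ^ 'n" and nd :: "'n \<Rightarrow> 'v" and L :: "'l set"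
  assumes "finite L" "indexed_by nd V v" "\<And>i. i \<in> V \<Longrightarrow> real (card {l\<in>L. i \<in> S l}) \<le> C"
  shows "(\<Sum>l\<in>L. (norm (subvec nd v (S l)))\<^sup>2) \<le> C * (norm v)\<^sup>2"
  unfolding sum_norm_subvec[OF assms(1)] norm_square_cart[of v] sum_distrib_left
proof (rule sum_mono)
  show "real (card {l\<in>L. nd p \<in> S l}) * (v $ p)\<^sup>2 \<le> C * (v $ p)\<^sup>2" for p
    using assms(2,3) by (cases "nd p \<in> V") (auto simp: indexed_by_def intro: mult_right_mono)
qed

lemma sum_norm_subvec_partition:
  fixes v :: "real ^ 'n" and nd :: "'n \<Rightarrow> 'v" and L :: "'l set"
  assumes "finite L" "indexed_by nd V v" "\<And>i. i \<in> V \<Longrightarrow> card {l\<in>L. i \<in> S l} = 1"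
  shows "(\<Sum>l\<in>L. (norm (subvec nd v (S l)))\<^sup>2) = (norm v)\<^sup>2"
  unfolding sum_norm_subvec[OF assms(1)] norm_square_cart[of v]
proof (rule sum.cong[OF refl])
  show "real (card {l\<in>L. nd p \<in> S l}) * (v $ p)\<^sup>2 = (v $ p)\<^sup>2" for p
    using assms(2,3) by (cases "nd p \<in> V") (auto simp: indexed_by_def)
qed

section \<open>Matrices whose sparsity follows the graph\<close>

text \<open>This replaces zero-extended submatrices by compositions with projections, the form in
  which the KKT operator is studied.\<close>

lemma submat_matvec: "submat rd cd A I J *v v = subvec rd (A *v subvec cd v J) I"
  by (auto simp: submat_def subvec_def matrix_vector_mult_def vec_eq_iff if_distrib cong: if_cong intro!: sum.cong)

lemma indexed_by_matvec:
  assumes "\<And>p q. A $ p $ q \<noteq> 0 \<Longrightarrow> cd q \<in> J \<Longrightarrow> rd p \<in> I" "indexed_by cd J v"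
  shows "indexed_by rd I (A *v v)"
  using assms unfolding indexed_by_def matrix_vector_mult_def
  by (auto intro!: sum.neutral) (metis mult_eq_0_iff)

text \<open>Rows in \<open>I\<close> have zero entries in all columns outside \<open>J\<close>, so
  truncating the argument to \<open>J\<close> goes unnoticed by them.\<close>

lemma subvec_matvec_cong:
  assumes "\<And>p q. A $ p $ q \<noteq> 0 \<Longrightarrow> rd p \<in> I \<Longrightarrow> cd q \<in> J"
  shows "subvec rd (A *v subvec cd v J) I = subvec rd (A *v v) I"
proof -
  have "(\<Sum>q\<in>UNIV. A $ p $ q * (if cd q \<in> J then v $ q else 0)) = (\<Sum>q\<in>UNIV. A $ p $ q * v $ q)"
    if "rd p \<in> I" for p
    using assms[of p] that by (intro sum.cong) auto
  then show ?thesis by (simp add: subvec_def matrix_vector_mult_def vec_eq_iff)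
qed

lemma block_eq_zeroD:
  assumes "block rd cd A (rd p) (cd q) = 0"
  shows "A $ p $ q = 0"
proof -
  have "block rd cd A (rd p) (cd q) $ p $ q = 0" using assms by simp
  then show ?thesis by (simp add: submat_def)
qed

lemma inner_transpose: "(A *v x) \<bullet> y = x \<bullet> (transpose A *v y)"
  for A :: "real ^ 'n ^ 'm"
  by (metis dot_lmul_matrix inner_commute transpose_matrix_vector vector_transpose_matrix)

lemma norm_transpose_le:
  fixes A :: "real ^ 'n ^ 'm"
  assumes "\<And>x. norm (A *v x) \<le> U * norm x"
  shows "norm (transpose A *v y) \<le> U * norm y"
proof (cases "transpose A *v y = 0")
  case True
  have "0 \<le> U * norm y"
  proof (cases "y = 0")
    case False
    \<comment> \<open>Nonnegativity of \<open>U\<close> is read off from the hypothesis at a unit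
      vector.\<close>
    have "0 \<le> U * norm (axis undefined 1 :: real ^ 'n)" using assms norm_ge_zero order_trans by blast
    then show ?thesis by simp
  qed simp
  then show ?thesis using True by simp
next
  case False
  have "(norm (transpose A *v y))\<^sup>2 = (A *v (transpose A *v y)) \<bullet> y"
    by (simp add: power2_norm_eq_inner inner_transpose)
  also have "\<dots> \<le> U * norm (transpose A *v y) * norm y"
    using norm_cauchy_schwarz assms by (meson mult_right_mono norm_ge_zero order_trans)
  finally show ?thesis using False by (simp add: power2_eq_square)
qed

text \<open>A block version of the Schur test. Cauchy-Schwarz along a block row costs one factor
  \<open>C\<close> for the number of nonzero blocks; summing over the rows costs a second one, since
  symmetry of \<open>R\<close> bounds the blocks in a column by the same number. Together they give
  \<open>C\<close> in the unsquared norm.\<close>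

lemma norm_matvec_le_blocks:
  fixes A :: "real ^ 'n ^ 'm" and rd :: "'m \<Rightarrow> 'v" and cd :: "'n \<Rightarrow> 'v"
  assumes fin: "finite V" and U: "0 \<le> U" "0 \<le> C"
    and bound: "\<And>i j. i \<in> V \<Longrightarrow> j \<in> V \<Longrightarrow> spectral_norm (block rd cd A i j) \<le> U"
    and local: "\<And>p q. A $ p $ q \<noteq> 0 \<Longrightarrow> rd p \<in> V \<and> cd q \<in> V \<and> R (rd p) (cd q)"
    and sym: "\<And>i j. R i j \<Longrightarrow> R j i"
    and row: "\<And>i. i \<in> V \<Longrightarrow> real (card {j\<in>V. R i j}) \<le> C"
  shows "norm (A *v v) \<le> U * C * norm v"
proof -
  define N where "N = (\<lambda>i. {j\<in>V. R i j})"
  define w where "w = (\<lambda>j. norm (subvec cd v {j}))"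
  have finN: "finite (N i)" for i using fin by (simp add: N_def)
  have bl: "norm (block rd cd A i j *v v) \<le> U * w j" if "i \<in> V" "j \<in> V" for i j
  proof -
    have "block rd cd A i j *v v = block rd cd A i j *v subvec cd v {j}"
      by (simp add: submat_matvec)
    also have "norm \<dots> \<le> spectral_norm (block rd cd A i j) * w j"
      unfolding spectral_norm_def w_def by (intro onorm matrix_vector_mul_bounded_linear)
    also have "\<dots> \<le> U * w j" using bound[OF that] by (intro mult_right_mono) (simp_all add: w_def)
    finally show ?thesis .
  qed
  have row_i: "(norm (subvec rd (A *v v) {i}))\<^sup>2 \<le> C * U\<^sup>2 * (\<Sum>j\<in>N i. (w j)\<^sup>2)" if "i \<in> V" for i
  proof -
    have "subvec rd (A *v v) {i} = (\<Sum>j\<in>N i. block rd cd A i j *v v)"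
    proof (rule vec_eq_iff[THEN iffD2], rule allI)
      fix p
      have "(\<Sum>j\<in>N i. block rd cd A i j *v v) $ p
          = (\<Sum>j\<in>N i. \<Sum>q\<in>UNIV. if rd p = i \<and> cd q = j then A $ p $ q * v $ q else 0)"
        by (simp add: submat_def matrix_vector_mult_def if_distrib if_distribR cong: if_cong)
      also have "\<dots> = (\<Sum>q\<in>UNIV. \<Sum>j\<in>N i. if rd p = i \<and> cd q = j then A $ p $ q * v $ q else 0)"
        by (rule sum.swap)
      also have "\<dots> = (\<Sum>q\<in>UNIV. if rd p = i then A $ p $ q * v $ q else 0)"
      proof (rule sum.cong[OF refl])
        fix q
        show "(\<Sum>j\<in>N i. if rd p = i \<and> cd q = j then A $ p $ q * v $ q else 0)
          = (if rd p = i then A $ p $ q * v $ q else 0)"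
          using local[of p q] finN[of i] by (cases "rd p = i"; cases "A $ p $ q = 0") (auto simp: N_def)
      qed
      also have "\<dots> = subvec rd (A *v v) {i} $ p"
        by (simp add: subvec_def matrix_vector_mult_def)
      finally show "subvec rd (A *v v) {i} $ p = (\<Sum>j\<in>N i. block rd cd A i j *v v) $ p" by simp
    qed
    then have "norm (subvec rd (A *v v) {i}) \<le> (\<Sum>j\<in>N i. U * w j)"
      using bl[OF that] by (auto simp: N_def intro!: sum_norm_le)
    then have "(norm (subvec rd (A *v v) {i}))\<^sup>2 \<le> (\<Sum>j\<in>N i. U * w j)\<^sup>2" by (rule power_mono) simp
    also have "\<dots> \<le> real (card (N i)) * (\<Sum>j\<in>N i. (U * w j)\<^sup>2)"
      using sum_squared_le_sum_of_squares[of "\<lambda>j. U * w j" "N i"] by (simp add: mult.commute)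
    also have "\<dots> \<le> C * (\<Sum>j\<in>N i. (U * w j)\<^sup>2)"
      using row[OF that] by (intro mult_right_mono sum_nonneg) (auto simp: N_def)
    finally show ?thesis by (simp add: power_mult_distrib sum_distrib_left mult.assoc)
  qed
  have part: "(\<Sum>i\<in>V. (norm (subvec nd u {i}))\<^sup>2) = (norm u)\<^sup>2"
    if "indexed_by nd V u" for nd :: "'k::finite \<Rightarrow> 'v" and u :: "real ^ 'k"
  proof (rule sum_norm_subvec_partition[OF fin that])
    show "card {l\<in>V. i \<in> {l}} = 1" if "i \<in> V" for i
    proof -
      have "{l\<in>V. i \<in> {l}} = {i}" using that by auto
      then show ?thesis by simp
    qed
  qed
  have "(norm (A *v v))\<^sup>2 = (\<Sum>i\<in>V. (norm (subvec rd (A *v v) {i}))\<^sup>2)"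
    by (rule part[symmetric], rule indexed_by_matvec[where J = UNIV and cd = cd])
      (use local in \<open>auto simp: indexed_by_def\<close>)
  also have "\<dots> \<le> (\<Sum>i\<in>V. C * U\<^sup>2 * (\<Sum>j\<in>N i. (w j)\<^sup>2))" by (rule sum_mono) (rule row_i)
  also have "\<dots> = C * U\<^sup>2 * (\<Sum>i\<in>V. \<Sum>j\<in>V. if R i j then (w j)\<^sup>2 else 0)"
    using fin by (simp add: N_def sum_distrib_left[symmetric] sum.inter_filter)
  \<comment> \<open>Exchanging the sums turns row counts into column counts, which symmetry turns
    back into row counts.\<close>
  also have "(\<Sum>i\<in>V. \<Sum>j\<in>V. if R i j then (w j)\<^sup>2 else 0) = (\<Sum>j\<in>V. \<Sum>i\<in>V. if R j i then (w j)\<^sup>2 else 0)"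
    using sym by (subst sum.swap, intro sum.cong refl if_cong) auto
  also have "\<dots> = (\<Sum>j\<in>V. real (card (N j)) * (w j)\<^sup>2)"
    using fin by (simp add: N_def sum.inter_filter[symmetric])
  also have "C * U\<^sup>2 * \<dots> \<le> C * U\<^sup>2 * (\<Sum>j\<in>V. C * (w j)\<^sup>2)"
    using row U by (intro mult_left_mono sum_mono mult_right_mono) (auto simp: N_def)
  also have "\<dots> = (U * C)\<^sup>2 * (norm (subvec cd v V))\<^sup>2"
  proof -
    have "(\<Sum>j\<in>V. (w j)\<^sup>2) = (\<Sum>j\<in>V. (norm (subvec cd (subvec cd v V) {j}))\<^sup>2)"
      by (intro sum.cong refl) (simp add: w_def subvec_subvec Int_absorb1)
    then show ?thesis
      using part[of cd "subvec cd v V"]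
      by (simp add: sum_distrib_left[symmetric] power_mult_distrib power2_eq_square mult_ac)
  qed
  also have "\<dots> \<le> (U * C)\<^sup>2 * (norm v)\<^sup>2"
    by (intro mult_left_mono power_mono norm_subvec_le) auto
  finally have "(norm (A *v v))\<^sup>2 \<le> (U * C * norm v)\<^sup>2" by (simp add: power_mult_distrib)
  then show ?thesis by (rule power2_le_imp_le) (use U in simp)
qed

section \<open>The KKT operator of a subproblem\<close>

declare transpose_matrix_vector [simp del]

section \<open>Neighbourhoods and supports far from a set\<close>

lemma mem_open_nbhd_iff:
  "i \<in> open_nbhd V E W \<longleftrightarrow> i \<in> V \<and> i \<notin> W \<and> (\<exists>j\<in>W. gdist E i j \<le> enat 1)"
  unfolding open_nbhd_def Diff_iff mem_closed_nbhd_iff by blast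

text \<open>The elements at distance at least \<open>n\<close> from \<open>S\<close>. Negating
  finite bounds makes everything unreachable from \<open>S\<close> far at every level.\<close>

definition far :: "('v \<times> 'v) set \<Rightarrow> 'v set \<Rightarrow> nat \<Rightarrow> 'v set" where
  "far E S n = {i. \<forall>v\<in>S. \<forall>m<n. \<not> gdist E v i \<le> enat m}"

lemma far_step:
  assumes "sym E" "gdist E i j \<le> enat k" "j \<in> far E S (n + k)"
  shows "i \<in> far E S n"
  unfolding far_def
proof (intro CollectI ballI allI impI notI)
  fix v m assume v: "v \<in> S" "m < n" "gdist E v i \<le> enat m"
  have "gdist E v j \<le> enat (m + k)" using v(3) assms(2) by (rule gdist_triangle)
  then show False using assms(3) v by (auto simp: far_def)
qed

lemma far_antimono: "m \<le> n \<Longrightarrow> far E S n \<subseteq> far E S m"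
  by (auto simp: far_def)

lemma indexed_by_far_matvec:
  assumes "sym E" "\<And>p q. A $ p $ q \<noteq> 0 \<Longrightarrow> gdist E (rd p) (cd q) \<le> enat k"
    and "indexed_by cd (far E S (n + k)) v"
  shows "indexed_by rd (far E S n) (A *v v)"
proof (rule indexed_by_matvec[OF _ assms(3)])
  fix p q assume "A $ p $ q \<noteq> 0" "cd q \<in> far E S (n + k)"
  then show "rd p \<in> far E S n" using far_step[OF assms(1) assms(2)] by simp
qed

lemma indexed_by_subvecI: "indexed_by nd J v \<Longrightarrow> indexed_by nd J (subvec nd v I)"
  by (auto simp: indexed_by_def subvec_def)

lemma indexed_by_add: "indexed_by nd I u \<Longrightarrow> indexed_by nd I v \<Longrightarrow> indexed_by nd I (u + v)"
  by (simp add: indexed_by_def)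

lemma indexed_by_scaleR: "indexed_by nd I v \<Longrightarrow> indexed_by nd I (c *\<^sub>R v)"
  by (simp add: indexed_by_def)

text \<open>Meant for the antidiagonal part of the KKT operator: its two components depend on
  different halves of the argument, so the bound is \<open>U\<close> and not
  \<open>2 * U\<close>.\<close>

lemma norm_swap_pair_le:
  assumes "norm u \<le> U * norm q" "norm v \<le> U * norm p" "0 \<le> U"
  shows "norm (u, v) \<le> U * norm (p, q)"
proof -
  have "(norm u)\<^sup>2 + (norm v)\<^sup>2 \<le> (U * norm q)\<^sup>2 + (U * norm p)\<^sup>2"
    using assms by (intro add_mono power_mono) auto
  also have "\<dots> = U\<^sup>2 * ((norm p)\<^sup>2 + (norm q)\<^sup>2)" by (simp add: power_mult_distrib algebra_simps)
  finally have "sqrt ((norm u)\<^sup>2 + (norm v)\<^sup>2) \<le> sqrt (U\<^sup>2 * ((norm p)\<^sup>2 + (norm q)\<^sup>2))" by simp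
  then show ?thesis using assms(3) by (simp add: norm_Pair real_sqrt_mult)
qed

section \<open>The data of one Newton iteration\<close>

text \<open>One iteration is frozen: \<open>Hm\<close> is the modified Hessian, \<open>Gm\<close>
  the constraint Jacobian, \<open>h\<close> and \<open>g\<close> are \<gamma>H and \<gamma>G, and
  \<open>U\<close> takes the place of \<open>Ups_hat\<close>. The block bounds enter as bounds on
  operator norms.\<close>

locale graph_kkt =
  fixes V :: "'v set" and E :: "('v \<times> 'v) set"
    and pn :: "'p::finite \<Rightarrow> 'v" and dn :: "'d::finite \<Rightarrow> 'v"
    and Hm :: "real ^ 'p ^ 'p" and Gm :: "real ^ 'p ^ 'd"
    and h g U \<mu> :: real
  assumes graph: "undirected_graph V E"
    and H_sym: "transpose Hm = Hm"
    and H_local: "\<And>p q. Hm $ p $ q \<noteq> 0 \<Longrightarrow> pn p \<in> V \<and> pn q \<in> V \<and> gdist E (pn p) (pn q) \<le> enat 2"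
    and G_local: "\<And>d p. Gm $ d $ p \<noteq> 0 \<Longrightarrow> dn d \<in> V \<and> pn p \<in> V \<and> gdist E (dn d) (pn p) \<le> enat 1"
    and H_norm: "\<And>v. norm (Hm *v v) \<le> U * norm v"
    and G_norm: "\<And>v. norm (Gm *v v) \<le> U * norm v"
    and reduced: "\<And>v. indexed_by pn V v \<Longrightarrow> Gm *v v = 0 \<Longrightarrow> h * (norm v)\<^sup>2 \<le> v \<bullet> (Hm *v v)"
    and licq: "\<And>l. indexed_by dn V l \<Longrightarrow> g * (norm l)\<^sup>2 \<le> (norm (transpose Gm *v l))\<^sup>2"
    and const: "0 < h" "h \<le> 1" "0 < g" "g \<le> 1" "1 \<le> U" "4 * U\<^sup>2 / (g * h) \<le> \<mu>"
begin

abbreviation Ha :: "real ^ 'p \<Rightarrow> real ^ 'p" where "Ha \<equiv> (*v) Hm"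
abbreviation Ga :: "real ^ 'p \<Rightarrow> real ^ 'd" where "Ga \<equiv> (*v) Gm"
abbreviation Gt :: "real ^ 'd \<Rightarrow> real ^ 'p" where "Gt \<equiv> (*v) (transpose Gm)"

text \<open>\<open>CK\<close> and \<open>gK\<close> are \<open>Ups_K\<close> and
  \<open>gamma_K\<close> with \<open>U\<close> in place of \<open>Ups_hat\<close>.\<close>

abbreviation CK :: real where "CK \<equiv> 3/2 * \<mu> * U\<^sup>2"
abbreviation gK :: real where "gK \<equiv> h ^ 3 * g ^ 2 / (75 * CK ^ 6)"

lemma symE: "sym E" using graph by (simp add: undirected_graph_def)

lemma Ga_adj: "Ga x \<bullet> y = x \<bullet> Gt y" by (rule inner_transpose)

lemma Gt_adj: "Gt y \<bullet> x = y \<bullet> Ga x" by (metis Ga_adj inner_commute)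

lemma Ha_adj: "Ha x \<bullet> y = x \<bullet> Ha y" by (simp add: inner_transpose H_sym)

lemma Gt_norm: "norm (Gt v) \<le> U * norm v" by (rule norm_transpose_le) (rule G_norm)

lemma Gt_local: "transpose Gm $ p $ d \<noteq> 0 \<Longrightarrow> pn p \<in> V \<and> dn d \<in> V \<and> gdist E (pn p) (dn d) \<le> enat 1"
  using G_local[of d p] gdist_commute[OF symE] by (simp add: transpose_def)

lemma mu_ge: "4 * U\<^sup>2 \<le> \<mu>"
proof -
  have "g * h \<le> 1 * 1" using const by (intro mult_mono) auto
  then have "4 * U\<^sup>2 \<le> 4 * U\<^sup>2 / (g * h)" using const by (simp add: le_divide_eq mult_left_le)
  then show ?thesis using const by linarith
qed

text \<open>The sum \<open>2 * U + \<mu> * U\<^sup>2\<close> is what the norm estimates of the KKT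
  operator produce. Since \<open>4 * U\<close> is at most \<mu>, its first term is at most half of
  the second, which explains the factor \<open>3/2\<close> in \<open>CK\<close>.\<close>

lemma mu_pos: "0 < \<mu>" and CK_ge: "2 * U + \<mu> * U\<^sup>2 \<le> CK" "1 \<le> CK"
proof -
  have U2: "1 \<le> U\<^sup>2" "U \<le> U\<^sup>2" using const(5) self_le_power[of U 2] by (auto simp: one_le_power)
  then show p: "0 < \<mu>" using mu_ge by linarith
  have "4 * U \<le> \<mu>" using mu_ge U2 by linarith
  also have "\<mu> * 1 \<le> \<mu> * U\<^sup>2" using p U2 by (intro mult_left_mono) auto
  finally show "2 * U + \<mu> * U\<^sup>2 \<le> CK" by simp
  moreover have "0 \<le> \<mu> * U\<^sup>2" using p by simp
  ultimately show "1 \<le> CK" using const by linarith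
qed

lemma gK_pos: "0 < gK" using const CK_ge(2) mu_pos by simp

lemma gK_le: "gK \<le> 1"
proof -
  have "h ^ 3 * g ^ 2 \<le> 1 * 1" using const by (intro mult_mono power_le_one) auto
  moreover have "1 \<le> CK ^ 6" using CK_ge(2) by (rule one_le_power)
  ultimately have "h ^ 3 * g ^ 2 \<le> 75 * CK ^ 6" by linarith
  moreover have "0 < 75 * CK ^ 6" using \<open>1 \<le> CK ^ 6\<close> by linarith
  ultimately show ?thesis by (simp only: divide_le_eq_1_pos)
qed

lemma gK_le_CK: "gK \<le> CK" using gK_le CK_ge(2) by linarith

lemma decay_factor_nonneg: "0 \<le> ((CK\<^sup>2 - gK\<^sup>2) / (CK\<^sup>2 + gK\<^sup>2)) ^ n / gK"
proof (rule divide_nonneg_nonneg[OF zero_le_power less_imp_le[OF gK_pos]])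
  have "gK\<^sup>2 \<le> CK\<^sup>2" using gK_le_CK less_imp_le[OF gK_pos] by (rule power_mono)
  then have "0 \<le> CK\<^sup>2 - gK\<^sup>2" by (simp only: diff_ge_0_iff_ge)
  moreover have "0 \<le> CK\<^sup>2 + gK\<^sup>2" by (intro add_nonneg_nonneg zero_le_power2)
  ultimately show "0 \<le> (CK\<^sup>2 - gK\<^sup>2) / (CK\<^sup>2 + gK\<^sup>2)" by (rule divide_nonneg_nonneg)
qed

lemma aug_coercive:
  assumes "indexed_by pn V v"
  shows "h / 2 * (norm v)\<^sup>2 \<le> v \<bullet> Ha v + \<mu> * (norm (Ga v))\<^sup>2"
proof (rule augmented_form_coercive[where X = "{v. indexed_by pn V v}" and Y = "{l. indexed_by dn V l}"
      and U = U and g = g and A = Ha and B = Ga and Bt = Gt and p = v])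
  show "Gt y \<in> {v. indexed_by pn V v}" for y
    unfolding mem_Collect_eq
    by (rule indexed_by_matvec[where J = UNIV and cd = dn]) (auto dest: Gt_local simp: indexed_by_def)
  show "Ga x \<in> {l. indexed_by dn V l}" for x
    unfolding mem_Collect_eq
    by (rule indexed_by_matvec[where J = UNIV and cd = pn]) (auto dest: G_local simp: indexed_by_def)
  show "Ha x \<bullet> y = x \<bullet> Ha y" for x y by (rule Ha_adj)
  show "Ga x \<bullet> y = x \<bullet> Gt y" for x y by (rule Ga_adj)
  show "norm (Ha x) \<le> U * norm x" for x by (rule H_norm)
  show "g * (norm y)\<^sup>2 \<le> (norm (Gt y))\<^sup>2" if "y \<in> {l. indexed_by dn V l}" for y
    using that licq by simp
  show "h * (norm x)\<^sup>2 \<le> x \<bullet> Ha x" if "x \<in> {v. indexed_by pn V v}" "Ga x = 0" for x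
    using that reduced by simp
  show "v \<in> {v. indexed_by pn V v}" using assms by simp
qed (rule const matrix_vector_mul_linear subspace_indexed_by)+

end

section \<open>Exact and penalised constraints of one subproblem\<close>

locale kkt_subproblem = graph_kkt V E pn dn Hm Gm h g U \<mu>
  for V :: "'v set" and E and pn :: "'p::finite \<Rightarrow> 'v" and dn :: "'d::finite \<Rightarrow> 'v"
    and Hm Gm h g U \<mu> +
  fixes W :: "'v set"
  assumes W: "W \<subseteq> V"
begin

abbreviation Wh where "Wh \<equiv> W_hat V E W"
abbreviation B where "B \<equiv> W - W_tilde V E W"
abbreviation N2 where "N2 \<equiv> closed_nbhd V E 2 W"
abbreviation PW where "PW v \<equiv> subvec pn v W"
abbreviation PB where "PB v \<equiv> subvec dn v B"
abbreviation Ph where "Ph v \<equiv> subvec dn v Wh"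

text \<open>A penalised row outside \<open>W\<close> is its own witness; one in
  \<open>W_tilde\<close> is adjacent to an open neighbour of \<open>W\<close>. Penalised rows thus
  stay close to the complement of \<open>W\<close> and away from the part that the subproblem
  owns.\<close>

lemma Wh_outside:
  assumes "i \<in> Wh"
  obtains j where "j \<in> V - W" "gdist E i j \<le> enat 1"
proof (cases "i \<in> open_nbhd V E W")
  case True
  then show thesis using that[of i] gdist_self[of E i 1] by (simp add: mem_open_nbhd_iff)
next
  case False
  then have "i \<in> open_nbhd V E (open_nbhd V E W)" using assms by (auto simp: W_hat_def W_tilde_def)
  then obtain j where "j \<in> open_nbhd V E W" "gdist E i j \<le> enat 1"
    unfolding mem_open_nbhd_iff[of i V E "open_nbhd V E W"] by blast
  then show thesis using that[of j] unfolding mem_open_nbhd_iff[of j V E W] by blast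
qed

text \<open>A constraint in \<open>W\<close> that reads a variable outside \<open>W\<close> is
  adjacent to an open neighbour of \<open>W\<close>, hence belongs to \<open>W_tilde\<close>. The
  rows in \<open>B\<close> are therefore complete rows of the full Jacobian and inherit
  \<open>licq\<close>.\<close>

lemma row_inside:
  assumes "Gm $ d $ p \<noteq> 0" "dn d \<in> B"
  shows "pn p \<in> W"
proof (rule ccontr)
  assume out: "pn p \<notin> W"
  have "pn p \<in> open_nbhd V E W"
    using assms out G_local[OF assms(1)] gdist_commute[OF symE] by (auto simp: mem_open_nbhd_iff)
  then have "dn d \<in> W_tilde V E W"
    using assms G_local[OF assms(1)] unfolding W_tilde_def by (auto simp: mem_open_nbhd_iff[of _ _ _ "open_nbhd V E W"] mem_open_nbhd_iff[of _ _ _ W])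
  then show False using assms by simp
qed

text \<open>Exact and penalised rows together catch every constraint that sees \<open>W\<close>. On
  the kernel of the exact rows the penalty is therefore the full one.\<close>

lemma col_touch:
  assumes "Gm $ d $ p \<noteq> 0" "pn p \<in> W"
  shows "dn d \<in> B \<union> Wh"
  using assms G_local[OF assms(1)] by (auto simp: W_hat_def mem_open_nbhd_iff)

lemma subset_closed_nbhd: "W \<subseteq> closed_nbhd V E n W"
proof
  fix i assume "i \<in> W"
  then show "i \<in> closed_nbhd V E n W" using W gdist_self[of E i n] unfolding mem_closed_nbhd_iff by blast
qed

lemma Wh_near: "Wh \<subseteq> closed_nbhd V E 1 W"
  using subset_closed_nbhd[of 1] unfolding W_hat_def W_tilde_def open_nbhd_def by blast

lemma Wh_N2: "Wh \<subseteq> N2"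
proof
  fix i assume "i \<in> Wh"
  then have "i \<in> closed_nbhd V E 1 W" using Wh_near by (rule subsetD[rotated])
  then obtain j where "i \<in> V" "j \<in> W" "gdist E i j \<le> enat 1" unfolding mem_closed_nbhd_iff by blast
  moreover from this have "gdist E i j \<le> enat 2" by (meson enat_ord_simps(1) one_le_numeral order_trans)
  ultimately show "i \<in> N2" unfolding mem_closed_nbhd_iff by blast
qed

lemma hat_row_near:
  assumes "Gm $ d $ p \<noteq> 0" "dn d \<in> Wh"
  shows "pn p \<in> N2"
proof -
  have "dn d \<in> closed_nbhd V E 1 W" using Wh_near assms(2) by (rule subsetD)
  then obtain j where "j \<in> W" "gdist E (dn d) j \<le> enat 1" unfolding mem_closed_nbhd_iff by blast
  moreover have "gdist E (pn p) (dn d) \<le> enat 1" "pn p \<in> V"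
    using G_local[OF assms(1)] gdist_commute[OF symE] by auto
  ultimately show ?thesis
    using gdist_triangle[of E "pn p" "dn d" 1 j 1] by (auto simp: mem_closed_nbhd_iff numeral_2_eq_2)
qed

lemma B_Wh_disjoint: "B \<inter> Wh = {}"
  by (auto simp: W_hat_def mem_open_nbhd_iff)

lemma Gt_PB_indexed: "indexed_by pn W (Gt (PB q))"
  by (rule indexed_by_matvec[where J = B and cd = dn]) (auto simp: transpose_def dest: row_inside)

lemma PB_Ga: "PB (Ga (PW p)) = PB (Ga p)"
  by (rule subvec_matvec_cong) (auto dest: row_inside)

section \<open>Self-adjointness and spectral bounds of the KKT operator\<close>

text \<open>The Hessian of the penalised objective, extended by zero outside
  \<open>W\<close>.\<close>

definition A :: "real ^ 'p \<Rightarrow> real ^ 'p" where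
  "A p = PW (Ha (PW p)) + \<mu> *\<^sub>R PW (Gt (Ph (Ga (PW p))))"

text \<open>The KKT matrix of the subproblem as an operator. Its off-diagonal parts carry no
  projection onto \<open>W\<close> because \<open>row_inside\<close> confines them to
  \<open>W\<close>.\<close>

definition K :: "(real ^ 'p) \<times> (real ^ 'd) \<Rightarrow> (real ^ 'p) \<times> (real ^ 'd)" where
  "K z = (A (fst z) + Gt (PB (snd z)), PB (Ga (fst z)))"

text \<open>The actual space of the subproblem. \<open>K\<close> annihilates pairs supported outside
  \<open>W\<close> and \<open>B\<close>, so lower bounds are sought on \<open>Z\<close>.\<close>

definition Z :: "((real ^ 'p) \<times> (real ^ 'd)) set" where
  "Z = {v. indexed_by pn W v} \<times> {l. indexed_by dn B l}"

lemma A_linear: "linear A"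
  unfolding A_def
  by (intro linearI) (simp_all add: subvec_add subvec_scale matrix_vector_right_distrib matrix_vector_mult_scaleR scaleR_right_distrib)

lemma K_linear: "linear K"
  unfolding K_def
  by (intro linearI) (simp_all add: linear_add[OF A_linear] linear_scale[OF A_linear] subvec_add subvec_scale
      matrix_vector_right_distrib matrix_vector_mult_scaleR scaleR_right_distrib)

lemma A_adj: "A x \<bullet> y = x \<bullet> A y"
proof -
  have form: "A x \<bullet> y = Ha (PW x) \<bullet> PW y + \<mu> * (Ph (Ga (PW x)) \<bullet> Ph (Ga (PW y)))" for x y
  proof -
    have "Ph (Ga (PW x)) \<bullet> Ph (Ga (PW y)) = Ph (Ph (Ga (PW x))) \<bullet> Ga (PW y)"
      by (simp only: inner_subvec)
    then show ?thesis by (simp add: A_def inner_add_left inner_subvec[of pn _ W y] Gt_adj)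
  qed
  show ?thesis
    using form[of x y] form[of y x] Ha_adj[of "PW x" "PW y"] by (simp add: inner_commute)
qed

lemma K_adj: "K x \<bullet> y = x \<bullet> K y"
proof -
  have 1: "Gt (PB q) \<bullet> p = q \<bullet> PB (Ga p)" for p q
    by (simp add: Gt_adj inner_subvec)
  have 2: "p \<bullet> Gt (PB q) = PB (Ga p) \<bullet> q" for p q
    using 1[of q p] by (simp add: inner_commute)
  show ?thesis
    by (simp add: K_def inner_prod_def inner_add_left inner_add_right 1 2 A_adj)
qed

lemma A_norm: "norm (A p) \<le> (U + \<mu> * U\<^sup>2) * norm p"
proof -
  have U: "0 \<le> U" using const by simp
  have 1: "norm (PW (Ha (PW p))) \<le> U * norm p"
    using norm_subvec_le[of pn "Ha (PW p)" W] H_norm[of "PW p"] mult_left_mono[OF norm_subvec_le[of pn p W] U]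
    by linarith
  have "norm (PW (Gt (Ph (Ga (PW p))))) \<le> norm (Gt (Ph (Ga (PW p))))" by (rule norm_subvec_le)
  also have "\<dots> \<le> U * norm (Ph (Ga (PW p)))" by (rule Gt_norm)
  also have "\<dots> \<le> U * norm (Ga (PW p))" using U by (intro mult_left_mono norm_subvec_le)
  also have "\<dots> \<le> U * (U * norm (PW p))" using U by (intro mult_left_mono G_norm)
  also have "\<dots> \<le> U * (U * norm p)" using U by (intro mult_left_mono norm_subvec_le)
  finally have 2: "norm (PW (Gt (Ph (Ga (PW p))))) \<le> U\<^sup>2 * norm p" by (simp add: power2_eq_square mult.assoc)
  have "norm (A p) \<le> norm (PW (Ha (PW p))) + norm (\<mu> *\<^sub>R PW (Gt (Ph (Ga (PW p)))))"
    unfolding A_def by (rule norm_triangle_ineq)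
  also have "\<dots> \<le> U * norm p + \<mu> * (U\<^sup>2 * norm p)"
    using add_mono[OF 1 mult_left_mono[OF 2 less_imp_le[OF mu_pos]]] mu_pos by simp
  finally show ?thesis by (simp add: algebra_simps)
qed

lemma Z_subspace: "subspace Z"
  unfolding Z_def by (intro subspace_Times subspace_indexed_by)

lemma K_Z: "K z \<in> Z"
  unfolding Z_def K_def A_def using Gt_PB_indexed by (auto intro!: indexed_by_add indexed_by_scaleR)

text \<open>The diagonal part contributes \<open>U + \<mu> * U\<^sup>2\<close> and the antidiagonal
  part another \<open>U\<close>.\<close>

lemma K_upper: "norm (K z) \<le> CK * norm z"
proof -
  obtain p q where z: "z = (p, q)" by (cases z)
  have U: "0 \<le> U" using const by simp
  have "norm (Gt (PB q)) \<le> U * norm q"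
    using Gt_norm[of "PB q"] mult_left_mono[OF norm_subvec_le[of dn q B] U] by linarith
  moreover have "norm (PB (Ga p)) \<le> U * norm p"
    using norm_subvec_le[of dn "Ga p" B] G_norm[of p] by linarith
  ultimately have 1: "norm (Gt (PB q), PB (Ga p)) \<le> U * norm z"
    unfolding z using U by (rule norm_swap_pair_le)
  have "norm (A p) \<le> (U + \<mu> * U\<^sup>2) * norm z"
    using A_norm[of p] mult_left_mono[OF norm_fst_le[of p q], of "U + \<mu> * U\<^sup>2"] U mu_pos by (simp add: z)
  then have 2: "norm (A p, 0 :: real ^ 'd) \<le> (U + \<mu> * U\<^sup>2) * norm z" by (simp add: norm_Pair)
  have "norm (K z) = norm ((A p, 0) + (Gt (PB q), PB (Ga p)))" by (simp add: K_def z)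
  also have "\<dots> \<le> norm (A p, 0 :: real ^ 'd) + norm (Gt (PB q), PB (Ga p))" by (rule norm_triangle_ineq)
  also have "\<dots> \<le> (2 * U + \<mu> * U\<^sup>2) * norm z" using 1 2 by (simp add: algebra_simps)
  also have "\<dots> \<le> CK * norm z" using CK_ge(1) by (rule mult_right_mono) simp
  finally show ?thesis .
qed

text \<open>The reduced Hessian bound concerns the full problem, so curvature on the larger kernel
  of the exact rows has to come from the penalty. For \<open>x\<close> in this kernel,
  \<open>Ga x\<close> lives on \<open>Wh\<close>, so the form of \<open>A\<close> is the augmented
  form of the full problem and \<open>aug_coercive\<close> applies.\<close>

lemma K_lower:
  assumes "z \<in> Z"
  shows "gK * norm z \<le> norm (K z)"
proof -
  obtain p q where z: "z = (p, q)" by (cases z)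
  have "gK * norm (p, q) \<le> norm (A p + Gt (PB q), PB (Ga p))"
  proof (rule saddle_point_lower_bound[where X = "{v. indexed_by pn W v}" and Y = "{l. indexed_by dn B l}"
        and A = A and B = "\<lambda>x. PB (Ga x)" and Bt = "\<lambda>y. Gt (PB y)" and p = p and q = q])
    have "(U + \<mu> * U\<^sup>2) * norm x \<le> CK * norm x" for x :: "real ^ 'p"
      using CK_ge(1) const by (intro mult_right_mono) auto
    then show "norm (A x) \<le> CK * norm x" for x using A_norm[of x] by (rule order_trans[rotated])
    show "linear (\<lambda>x. PB (Ga x))" "linear (\<lambda>y. Gt (PB y))"
      by (auto intro!: linearI simp: subvec_add subvec_scale matrix_vector_right_distrib matrix_vector_mult_scaleR)
    show "PB (Ga x) \<bullet> y = x \<bullet> Gt (PB y)" for x y by (simp add: inner_subvec Ga_adj)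
    show "g * (norm y)\<^sup>2 \<le> (norm (Gt (PB y)))\<^sup>2" if "y \<in> {l. indexed_by dn B l}" for y
      using that licq[of y] W indexed_by_subset[of dn B y V] by (auto simp: subvec_eq_iff[THEN iffD2])
    show "h / 2 * (norm x)\<^sup>2 \<le> x \<bullet> A x" if x: "x \<in> {v. indexed_by pn W v}" "PB (Ga x) = 0" for x
    proof -
      have xW: "PW x = x" using x by (simp add: subvec_eq_iff)
      have "indexed_by dn (B \<union> Wh) (Ga x)"
        using x(1) col_touch by (auto intro!: indexed_by_matvec[where J = W and cd = pn])
      then have "Ga x = subvec dn (Ga x) (B \<union> Wh)" by (simp add: subvec_eq_iff[THEN iffD2])
      also have "\<dots> = PB (Ga x) + Ph (Ga x)"
        using B_Wh_disjoint by (auto simp: subvec_def vec_eq_iff)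
      finally have Gx: "Ph (Ga x) = Ga x" using x(2) by simp
      have "x \<bullet> PW v = x \<bullet> v" for v by (simp add: inner_subvec[symmetric] xW)
      then have "x \<bullet> A x = x \<bullet> Ha x + \<mu> * (norm (Ga x))\<^sup>2"
        by (simp add: A_def xW inner_add_right Gx Ga_adj[symmetric] power2_norm_eq_inner)
      then show ?thesis using aug_coercive[of x] x W by (auto intro: indexed_by_subset)
    qed
  qed (use assms const CK_ge(2) A_linear Gt_PB_indexed subspace_indexed_by in \<open>auto simp: z Z_def\<close>)
  then show ?thesis by (simp add: z K_def)
qed


section \<open>Decay of the error of one subproblem\<close>

text \<open>The filtration fed into \<open>banded_solution_decay\<close>: pairs that vanish at
  distance less than \<open>n\<close> from \<open>S\<close>.\<close>

definition F :: "'v set \<Rightarrow> nat \<Rightarrow> ((real ^ 'p) \<times> (real ^ 'd)) set" where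
  "F S n = {v. indexed_by pn (far E S n) v} \<times> {l. indexed_by dn (far E S n) l}"

text \<open>The Hessian reaches two edges, and the penalty term reaches one with the Jacobian and
  one more with its transpose. The off-diagonal parts reach a single edge.\<close>

lemma K_band:
  assumes "z \<in> F S (n + 2)"
  shows "K z \<in> F S n"
proof -
  obtain p q where z: "z = (p, q)" by (cases z)
  have p: "indexed_by pn (far E S (n + 2)) p" and q: "indexed_by dn (far E S (n + 2)) q"
    using assms by (auto simp: z F_def)
  have H2: "indexed_by pn (far E S n) (Ha v)" if "indexed_by pn (far E S (n + 2)) v" for v
    by (rule indexed_by_far_matvec[OF symE _ that]) (use H_local in blast)
  have G1: "indexed_by dn (far E S m) (Ga v)" if "indexed_by pn (far E S (m + 1)) v" for m v
    by (rule indexed_by_far_matvec[OF symE _ that]) (use G_local in blast)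
  have Gt1: "indexed_by pn (far E S m) (Gt v)" if "indexed_by dn (far E S (m + 1)) v" for m v
    by (rule indexed_by_far_matvec[OF symE _ that]) (use Gt_local in blast)
  have n2: "n + 1 + 1 = n + 2" by simp
  have down: "indexed_by nd (far E S (n + 1)) v" if "indexed_by nd (far E S (n + 2)) v" for nd :: "'k::finite \<Rightarrow> 'v" and v
    by (rule indexed_by_subset[OF that far_antimono]) simp
  have "indexed_by pn (far E S n) (A p)"
    unfolding A_def
    by (intro indexed_by_add indexed_by_scaleR indexed_by_subvecI H2 Gt1 G1) (use p n2 in auto)
  moreover have "indexed_by pn (far E S n) (Gt (PB q))"
    by (intro Gt1 indexed_by_subvecI down q)
  moreover have "indexed_by dn (far E S n) (PB (Ga p))"
    by (intro G1 indexed_by_subvecI down p)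
  ultimately show ?thesis by (simp add: z K_def F_def indexed_by_add)
qed

text \<open>The subproblem solution is compared with the exact direction truncated to
  \<open>W\<close> and \<open>B\<close>. Truncation loses three couplings, collected in
  \<open>r\<close>: Hessian and penalty terms with the primal direction just outside
  \<open>W\<close>, and the multipliers on penalised rows.\<close>

lemma local_error:
  assumes S: "S \<subseteq> V" "closed_nbhd V E b S \<subseteq> W" "1 \<le> b"
    and exact: "Ha dx + Gt dl = - gx" "Ga dx = - cx"
    and \<omega>: "indexed_by pn W \<omega>" and \<zeta>: "indexed_by dn B \<zeta>"
    and stationary: "PW (Ha \<omega>) + PW gx + \<mu> *\<^sub>R PW (Gt (Ph (cx + Ga \<omega>))) + Gt \<zeta> = 0"
    and feasible: "PB (cx + Ga \<omega>) = 0"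
  shows "norm (subvec pn (\<omega> - dx) S, subvec dn (\<zeta> - dl) S)
    \<le> ((CK\<^sup>2 - gK\<^sup>2) / (CK\<^sup>2 + gK\<^sup>2)) ^ (b div 4) / gK * (CK * norm (subvec pn dx N2, subvec dn dl N2))"
proof -
  \<comment> \<open>The part of \<open>dx\<close> outside \<open>W\<close> that Hessian rows in
    \<open>W\<close> or penalised rows can read.\<close>
  define y where "y = subvec pn dx (N2 - W)"
  define u where "u = dx - PW dx"
  define e where "e = (\<omega> - PW dx, \<zeta> - PB dl)"
  define r where "r = PW (Ha y) + PW (Gt (Ph dl)) + \<mu> *\<^sub>R PW (Gt (Ph (Ga y)))"
  have y: "y = subvec pn u N2" by (auto simp: y_def u_def subvec_def vec_eq_iff)
  have b2: "gdist E v i \<le> enat b \<Longrightarrow> v \<in> S \<Longrightarrow> i \<in> V \<Longrightarrow> i \<in> W" for v i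
    using S(2) gdist_commute[OF symE] by (force simp: mem_closed_nbhd_iff)
  have SW: "S \<subseteq> W" using b2 gdist_self S(1) by (metis subset_eq)
  have SB: "S \<subseteq> B"
  proof
    fix v assume v: "v \<in> S"
    have "v \<notin> Wh"
    proof
      assume "v \<in> Wh"
      then obtain j where "j \<in> V - W" "gdist E v j \<le> enat 1" by (rule Wh_outside)
      then show False using b2[of v j] v S(3) order_trans[of "gdist E v j" "enat 1" "enat b"] by auto
    qed
    then show "v \<in> B" using v SW by (auto simp: W_hat_def)
  qed
  have Hu: "PW (Ha u) = PW (Ha y)"
    unfolding y
  proof (rule subvec_matvec_cong[symmetric])
    show "pn q \<in> N2" if "Hm $ p $ q \<noteq> 0" "pn p \<in> W" for p q
      using that H_local[OF that(1)] gdist_commute[OF symE] by (auto simp: mem_closed_nbhd_iff)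
  qed
  have Gu: "Ph (Ga u) = Ph (Ga y)"
    unfolding y by (rule subvec_matvec_cong[symmetric]) (rule hat_row_near)
  \<comment> \<open>Exact rows read nothing outside \<open>W\<close>, which is why the second
    component of the residual \<open>K e\<close> vanishes.\<close>
  have Bu: "PB (Ga u) = 0"
    using PB_Ga[of u] by (simp add: u_def subvec_diff subvec_zero)
  have Gl: "PW (Gt dl) = Gt (PB dl) + PW (Gt (Ph dl))"
  proof -
    have "PW (Gt dl) = PW (Gt (subvec dn dl (B \<union> Wh)))"
      by (rule subvec_matvec_cong[symmetric]) (use col_touch in \<open>auto simp: transpose_def\<close>)
    also have "subvec dn dl (B \<union> Wh) = PB dl + Ph dl"
      using B_Wh_disjoint by (auto simp: subvec_def vec_eq_iff)
    finally show ?thesis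
      using Gt_PB_indexed[of dl] by (simp add: subvec_add matrix_vector_right_distrib subvec_eq_iff[THEN iffD2])
  qed
  have dx: "dx = PW dx + u" by (simp add: u_def)
  have Hdx: "Ha dx = Ha (PW dx) + Ha u" and Gdx: "Ga dx = Ga (PW dx) + Ga u"
    by (simp_all add: u_def matrix_vector_mult_diff_distrib)
  have gx: "gx = - (Ha dx + Gt dl)" and cx: "cx = - Ga dx" using exact by simp_all
  \<comment> \<open>The exact linearised constraint eliminates \<open>cx\<close>, so the penalty
    term becomes homogeneous in the error up to the truncated part \<open>u\<close>.\<close>
  have cG: "cx + Ga \<omega> = Ga (fst e) - Ga u"
    by (simp add: cx e_def Gdx matrix_vector_mult_diff_distrib)
  have eW: "PW (fst e) = fst e" "PB (snd e) = snd e"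
    using \<omega> \<zeta> by (simp_all add: e_def subvec_diff subvec_eq_iff[THEN iffD2])
  have eZ: "e \<in> Z" using eW unfolding Z_def by (auto simp: subvec_eq_iff mem_Times_iff)
  have K1: "A (fst e) + Gt (PB (snd e)) = r"
  proof -
    have 1: "PW gx = - PW (Ha (PW dx)) - PW (Ha y) - Gt (PB dl) - PW (Gt (Ph dl))"
      by (simp add: gx Hdx subvec_neg subvec_add subvec_diff Hu Gl)
    have 2: "PW (Ha \<omega>) = PW (Ha (fst e)) + PW (Ha (PW dx))"
      by (simp add: e_def matrix_vector_mult_diff_distrib subvec_diff)
    have 3: "PW (Gt (Ph (cx + Ga \<omega>))) = PW (Gt (Ph (Ga (fst e)))) - PW (Gt (Ph (Ga y)))"
      by (simp add: cG subvec_diff Gu matrix_vector_mult_diff_distrib)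
    have 4: "Gt \<zeta> = Gt (snd e) + Gt (PB dl)"
      by (simp add: e_def matrix_vector_mult_diff_distrib)
    have "PW (Ha (fst e)) + \<mu> *\<^sub>R PW (Gt (Ph (Ga (fst e)))) + Gt (snd e) - r
        = PW (Ha \<omega>) + PW gx + \<mu> *\<^sub>R PW (Gt (Ph (cx + Ga \<omega>))) + Gt \<zeta>"
      unfolding 1 2 3 4 r_def by (simp add: algebra_simps)
    then have "PW (Ha (fst e)) + \<mu> *\<^sub>R PW (Gt (Ph (Ga (fst e)))) + Gt (snd e) = r"
      using stationary by simp
    then show ?thesis by (simp add: A_def eW)
  qed
  have K2: "PB (Ga (fst e)) = 0" using feasible Bu by (simp add: cG subvec_diff)
  have Ke: "K e = (r, 0)" by (simp add: K_def K1 K2)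
  have yV: "indexed_by pn (V - W) y"
    by (auto simp: y_def indexed_by_def subvec_def mem_closed_nbhd_iff)
  \<comment> \<open>All three terms of \<open>r\<close> start near the complement of
    \<open>W\<close>: the Hessian moves two edges from it, and a penalised row is at most one edge
    away before the transposed Jacobian adds another.\<close>
  define T where "T = {i. \<exists>j\<in>V - W. gdist E i j \<le> enat 2}"
  have T: "indexed_by pn T (Ha y)" "indexed_by pn T (Gt (Ph v))" for v
  proof -
    show "indexed_by pn T (Ha y)"
      by (rule indexed_by_matvec[OF _ yV]) (use H_local in \<open>auto simp: T_def\<close>)
    show "indexed_by pn T (Gt (Ph v))"
    proof (rule indexed_by_matvec[OF _ indexed_by_subvec])
      fix p d assume nz: "transpose Gm $ p $ d \<noteq> 0" and "dn d \<in> Wh"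
      then obtain j where "j \<in> V - W" "gdist E (dn d) j \<le> enat 1" by (auto elim: Wh_outside)
      then show "pn p \<in> T"
        using gdist_triangle[of E "pn p" "dn d" 1 j 1] Gt_local[OF nz] by (auto simp: T_def numeral_2_eq_2)
    qed
  qed
  \<comment> \<open>Nodes outside \<open>W\<close> are more than \<open>b\<close> away from
    \<open>S\<close>; subtracting the two edges of \<open>T\<close> leaves at least
    \<open>b - 1\<close>.\<close>
  have Tfar: "T \<subseteq> far E S (b - 1)"
    unfolding far_def
  proof (intro subsetI CollectI ballI allI impI notI)
    fix i v m assume "i \<in> T" "v \<in> S" "m < b - 1" "gdist E v i \<le> enat m"
    then obtain j where "j \<in> V - W" "gdist E i j \<le> enat 2" by (auto simp: T_def)
    then have "gdist E v j \<le> enat (m + 2)" using \<open>gdist E v i \<le> enat m\<close> by (intro gdist_triangle)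
    also have "\<dots> \<le> enat b" using \<open>m < b - 1\<close> by simp
    finally show False using b2[of v j] \<open>v \<in> S\<close> \<open>j \<in> V - W\<close> by auto
  qed
  have KF: "K e \<in> F S (b - 1)"
  proof -
    have "indexed_by pn T r"
      unfolding r_def using T by (intro indexed_by_add indexed_by_scaleR indexed_by_subvecI)
    then show ?thesis using indexed_by_subset[OF _ Tfar] by (simp add: Ke F_def indexed_by_def)
  qed
  have rn: "norm r \<le> CK * norm (subvec pn dx N2, subvec dn dl N2)"
  proof -
    define s where "s = norm (subvec pn dx N2, subvec dn dl N2)"
    have U: "0 \<le> U" using const by simp
    have ys: "norm y \<le> s"
      unfolding s_def y_def
      by (rule order_trans[OF norm_subvec_mono norm_fst_le]) auto
    have ls: "norm (Ph dl) \<le> s"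
      unfolding s_def by (rule order_trans[OF norm_subvec_mono[OF Wh_N2] norm_snd_le])
    have 1: "norm (PW (Ha y)) \<le> U * s"
      using norm_subvec_le[of pn "Ha y" W] H_norm[of y] mult_left_mono[OF ys U] by linarith
    have 2: "norm (PW (Gt (Ph v))) \<le> U * t" if "norm (Ph v) \<le> t" for v t
      using norm_subvec_le[of pn "Gt (Ph v)" W] Gt_norm[of "Ph v"] mult_left_mono[OF that U] by linarith
    have "norm (Ph (Ga y)) \<le> U * s"
      using norm_subvec_le[of dn "Ga y" Wh] G_norm[of y] mult_left_mono[OF ys U] by linarith
    from 2[OF this] have 3: "norm (\<mu> *\<^sub>R PW (Gt (Ph (Ga y)))) \<le> \<mu> * U\<^sup>2 * s"
      using mu_pos by (simp add: power2_eq_square mult.assoc)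
    have "norm r \<le> norm (PW (Ha y)) + norm (PW (Gt (Ph dl))) + norm (\<mu> *\<^sub>R PW (Gt (Ph (Ga y))))"
      unfolding r_def by (intro norm_triangle_le add_mono norm_triangle_ineq order_refl)
    also have "\<dots> \<le> (2 * U + \<mu> * U\<^sup>2) * s" using 1 2[OF ls] 3 by (simp add: algebra_simps)
    also have "\<dots> \<le> CK * s" using CK_ge(1) by (rule mult_right_mono) (simp add: s_def)
    finally show ?thesis by (simp add: s_def)
  qed
  have "norm (K e) = norm r" unfolding Ke by (simp add: norm_Pair)
  then have rn': "norm (K e) \<le> CK * norm (subvec pn dx N2, subvec dn dl N2)" using rn by (simp only:)
  define Q where "Q = (\<lambda>z :: (real ^ 'p) \<times> (real ^ 'd). (subvec pn (fst z) S, subvec dn (snd z) S))"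
  define \<kappa> where "\<kappa> = ((CK\<^sup>2 - gK\<^sup>2) / (CK\<^sup>2 + gK\<^sup>2)) ^ (b div 4) / gK"
  have Qe: "Q e = (subvec pn (\<omega> - dx) S, subvec dn (\<zeta> - dl) S)"
  proof -
    have "subvec pn (PW dx) S = subvec pn dx S" "subvec dn (PB dl) S = subvec dn dl S"
      unfolding subvec_subvec Int_absorb1[OF SW] Int_absorb1[OF SB] by (rule refl)+
    then show ?thesis by (simp add: Q_def e_def subvec_diff)
  qed
  have "norm (Q e) \<le> ((CK\<^sup>2 - gK\<^sup>2) / (CK\<^sup>2 + gK\<^sup>2)) ^ (b div 4) / gK * norm (K e)"
  proof (rule banded_solution_decay[OF K_linear Z_subspace K_Z K_adj K_lower K_upper gK_pos,
        where Q = Q and F = "F S" and e = e and D = "b - 1"])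
    show "gK \<le> CK" by (rule gK_le_CK)
    show "subspace (F S n)" for n unfolding F_def by (intro subspace_Times subspace_indexed_by)
    show "antimono (F S)"
      unfolding F_def using far_antimono by (fastforce intro!: monotoneI elim: indexed_by_subset)
    show "linear Q"
      by (rule linearI) (simp_all add: Q_def subvec_add subvec_scale)
    show "norm (Q x) \<le> norm x" for x
      unfolding Q_def by (cases x) (simp add: norm_Pair add_mono norm_subvec_le power_mono)
    show "Q x = 0" if "x \<in> F S 1" for x
    proof -
      have "S \<inter> far E S 1 = {}" using gdist_self[of E _ 0] by (auto simp: far_def)
      then show ?thesis
        using that by (auto simp: F_def Q_def indexed_by_def subvec_def vec_eq_iff zero_prod_def)
    qed
    \<comment> \<open>Since \<open>b\<close> is at least 1, the truncated subtraction is undone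
      here, and \<open>b div 4\<close> Richardson steps are available.\<close>
    show "4 * (b div 4) \<le> b - 1 + 1" using S(3) by simp
  qed (use eZ KF K_band in auto)
  then have "norm (Q e) \<le> \<kappa> * norm (K e)" unfolding \<kappa>_def .
  moreover have "\<kappa> * norm (K e) \<le> \<kappa> * (CK * norm (subvec pn dx N2, subvec dn dl N2))"
    unfolding \<kappa>_def by (rule mult_left_mono[OF rn' decay_factor_nonneg])
  ultimately have "norm (Q e) \<le> \<kappa> * (CK * norm (subvec pn dx N2, subvec dn dl N2))" by (rule order_trans)
  then show ?thesis unfolding Qe \<kappa>_def .
qed

end

section \<open>Stationarity and locality of the problem data\<close>

text \<open>Uniqueness of the derivative makes the explicit one vanish in every direction
  \<open>h\<close>; symmetry of \<open>S\<close> merges the two Hessian terms, so the gradient is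
  orthogonal to everything.\<close>

lemma quadratic_stationary:
  fixes S :: "real ^ 'p ^ 'p" and L B :: "real ^ 'p ^ 'd"
  assumes D: "((\<lambda>w. 1/2 * (w \<bullet> (S *v w)) + w \<bullet> k + \<mu>/2 * (norm (a + L *v w))\<^sup>2 + z \<bullet> (a' + B *v w))
      has_derivative (\<lambda>_. 0)) (at w)"
    and S: "transpose S = S"
  shows "S *v w + k + \<mu> *\<^sub>R (transpose L *v (a + L *v w)) + transpose B *v z = 0"
    (is "?g = 0")
proof -
  have M: "((*v) A has_derivative (*v) A) (at w)" for A :: "real ^ 'p ^ 'k"
    by (rule bounded_linear_imp_has_derivative) (rule matrix_vector_mul_bounded_linear)
  have "((\<lambda>w. 1/2 * (w \<bullet> (S *v w)) + w \<bullet> k + \<mu>/2 * ((a + L *v w) \<bullet> (a + L *v w)) + z \<bullet> (a' + B *v w))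
      has_derivative (\<lambda>h. 1/2 * (w \<bullet> (S *v h) + h \<bullet> (S *v w)) + h \<bullet> k
        + \<mu>/2 * ((a + L *v w) \<bullet> (L *v h) + (L *v h) \<bullet> (a + L *v w)) + z \<bullet> (B *v h))) (at w)"
    by (auto intro!: derivative_eq_intros M)
  from has_derivative_unique[OF this[folded power2_norm_eq_inner] D]
  have zero: "1/2 * (w \<bullet> (S *v h) + h \<bullet> (S *v w)) + h \<bullet> k
        + \<mu>/2 * ((a + L *v w) \<bullet> (L *v h) + (L *v h) \<bullet> (a + L *v w)) + z \<bullet> (B *v h) = 0" for h
    by metis
  have "w \<bullet> (S *v h) = h \<bullet> (S *v w)" for h
    using inner_transpose[of S w h] S by (simp add: inner_commute)
  then have "h \<bullet> ?g = 0" for h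
    using zero[of h]
    by (simp add: inner_transpose[symmetric] inner_add_right inner_commute[of z]
        inner_commute[of a] inner_commute[of "L *v w"] algebra_simps add_divide_distrib)
  then show ?thesis using inner_eq_zero_iff by blast
qed

lemma transpose_submat: "transpose (submat rd cd A I J) = submat cd rd (transpose A) J I"
  by (auto simp: transpose_def submat_def vec_eq_iff)

text \<open>Feasibility and stationarity in the projected form that \<open>local_error\<close>
  consumes.\<close>

lemma subproblem_kkt:
  fixes H :: "real ^ 'p ^ 'p" and G :: "real ^ 'p ^ 'd" and V W :: "'v set"
    and pn :: "'p \<Rightarrow> 'v" and dn :: "'d \<Rightarrow> 'v"
  assumes sol: "subproblem_solution V E pn dn H G gx cx \<mu> W \<omega> \<zeta>" and H: "transpose H = H"
  defines "B \<equiv> W - W_tilde V E W" and "Wh \<equiv> W_hat V E W"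
  shows "indexed_by pn W \<omega>" "indexed_by dn B \<zeta>" "subvec dn (cx + G *v \<omega>) B = 0"
    "subvec pn (H *v \<omega>) W + subvec pn gx W
      + \<mu> *\<^sub>R subvec pn (transpose G *v subvec dn (cx + G *v \<omega>) Wh) W
      + subvec pn (transpose G *v \<zeta>) W = 0"
proof -
  show \<omega>: "indexed_by pn W \<omega>" and \<zeta>: "indexed_by dn B \<zeta>"
    using sol by (auto simp: subproblem_solution_def is_arg_min_def B_def)
  then have [simp]: "subvec pn \<omega> W = \<omega>" "subvec dn \<zeta> B = \<zeta>" by (simp_all add: subvec_eq_iff)
  show "subvec dn (cx + G *v \<omega>) B = 0"
    using sol by (simp add: subproblem_solution_def is_arg_min_def subproblem_constraint_def
        submat_matvec subvec_add flip: B_def)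
  have D: "((\<lambda>w. 1/2 * (w \<bullet> (submat pn pn H W W *v w)) + w \<bullet> subvec pn gx W
      + \<mu>/2 * (norm (subvec dn cx Wh + submat dn pn G Wh W *v w))\<^sup>2
      + \<zeta> \<bullet> (subvec dn cx B + submat dn pn G B W *v w)) has_derivative (\<lambda>_. 0)) (at \<omega>)"
    using sol unfolding subproblem_solution_def subproblem_objective_def subproblem_constraint_def
      B_def Wh_def by simp
  show "subvec pn (H *v \<omega>) W + subvec pn gx W
      + \<mu> *\<^sub>R subvec pn (transpose G *v subvec dn (cx + G *v \<omega>) Wh) W
      + subvec pn (transpose G *v \<zeta>) W = 0"
    using quadratic_stationary[OF D]
    by (simp add: transpose_submat H submat_matvec subvec_add)
qed

section \<open>Sparsity of the constraint Jacobian\<close>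

text \<open>Restricted to the line through \<open>x\<close>, the component is constant, so the chain
  rule and uniqueness of the derivative apply.\<close>

lemma has_derivative_axis_zero:
  fixes \<phi> :: "real ^ 'n \<Rightarrow> real ^ 'm"
  assumes D: "(\<phi> has_derivative \<phi>') (at x)" and const: "\<And>t. \<phi> (x + t *\<^sub>R v) $ d = \<phi> x $ d"
  shows "\<phi>' v $ d = 0"
proof -
  have line: "((\<lambda>t. x + t *\<^sub>R v) has_derivative (\<lambda>t. t *\<^sub>R v)) (at (0::real))"
    by (auto intro!: derivative_eq_intros)
  have "((\<lambda>t. \<phi> (x + t *\<^sub>R v)) has_derivative (\<lambda>t. \<phi>' (t *\<^sub>R v))) (at (0::real))"
    using has_derivative_compose[OF line, of \<phi> \<phi>'] D by simp
  then have "((\<lambda>t. \<phi> (x + t *\<^sub>R v) $ d) has_derivative (\<lambda>t. \<phi>' (t *\<^sub>R v) $ d)) (at (0::real))"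
    by (rule bounded_linear.has_derivative[OF bounded_linear_vec_nth])
  then have "((\<lambda>t. \<phi> x $ d) has_derivative (\<lambda>t. \<phi>' (t *\<^sub>R v) $ d)) (at (0::real))"
    by (simp only: const)
  then have "(\<lambda>t. \<phi>' (t *\<^sub>R v) $ d) = (\<lambda>t::real. 0)"
    by (rule has_derivative_unique) simp
  from fun_cong[OF this, of 1] show ?thesis by simp
qed

text \<open>A component of \<open>c\<close> outside \<open>V\<close> is identically zero, and one
  inside does not change along a coordinate that it does not read.\<close>

lemma constraint_jacobian_local:
  fixes c :: "real ^ 'p::finite \<Rightarrow> real ^ 'd::finite"
  assumes nlp: "graph_nlp V E pn dn f c" and nz: "jacobian c (at x) $ d $ p \<noteq> 0"
  shows "dn d \<in> V \<and> pn p \<in> V \<and> gdist E (dn d) (pn p) \<le> enat 1"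
proof -
  obtain c' where "(c has_derivative c') (at x)"
    using nlp unfolding graph_nlp_def twice_continuously_differentiable_def by blast
  then have D: "(c has_derivative frechet_derivative c (at x)) (at x)"
    using differentiableI frechet_derivative_works by blast
  have nz': "frechet_derivative c (at x) (axis p 1) $ d \<noteq> 0"
    using nz by (simp add: jacobian_def matrix_def)
  have dV: "dn d \<in> V"
  proof (rule ccontr)
    assume "dn d \<notin> V"
    then have "c y $ d = 0" for y using nlp by (auto simp: graph_nlp_def indexed_by_def)
    then show False using has_derivative_axis_zero[OF D, of "axis p 1" d] nz' by simp
  qed
  have "pn p \<in> closed_nbhd V E 1 {dn d}"
  proof (rule ccontr)
    assume out: "pn p \<notin> closed_nbhd V E 1 {dn d}"
    have dep: "\<forall>x y. (\<forall>p. pn p \<in> closed_nbhd V E 1 {dn d} \<longrightarrow> x $ p = y $ p) \<longrightarrow> c x $ d = c y $ d"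
      using nlp dV by (simp add: graph_nlp_def)
    have "c (x + t *\<^sub>R axis p 1) $ d = c x $ d" for t
      using out by (intro dep[rule_format]) (auto simp: axis_def)
    then show False using has_derivative_axis_zero[OF D, of "axis p 1" d] nz' by simp
  qed
  moreover have "sym E" using nlp by (simp add: graph_nlp_def undirected_graph_def)
  ultimately show ?thesis
    using dV gdist_commute[of E "pn p"] by (auto simp: mem_closed_nbhd_iff)
qed

lemma gradient_dual: "gradient (\<lambda>l. lagrangian V f c x l) l = c x"
proof -
  have "((\<lambda>l. lagrangian V f c x l) has_derivative (\<lambda>h. h \<bullet> c x)) (at l)"
    unfolding lagrangian_def by (auto intro!: derivative_eq_intros)
  then have "frechet_derivative (\<lambda>l. lagrangian V f c x l) (at l) = (\<lambda>h. h \<bullet> c x)"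
    by (rule frechet_derivative_at[symmetric])
  then show ?thesis by (simp add: gradient_def vec_eq_iff inner_axis')
qed

section \<open>Counting tools and comparison of constants\<close>

lemma gdist_mem:
  assumes "undirected_graph V E" "i \<in> V" "gdist E i j \<le> enat n"
  shows "j \<in> V"
proof -
  obtain m where "(i, j) \<in> E ^^ m" using assms(3) unfolding gdist_le_iff by blast
  moreover have "E \<subseteq> V \<times> V" using assms(1) by (simp add: undirected_graph_def)
  ultimately show ?thesis
    using assms(2) by (cases m) auto
qed

lemma card_UN_le_mult:
  assumes "finite A" "real (card A) \<le> a" "\<And>k. k \<in> A \<Longrightarrow> real (card (N k)) \<le> c" "0 \<le> c"
  shows "real (card (\<Union>k\<in>A. N k)) \<le> a * c"
proof -
  have "real (card (\<Union>k\<in>A. N k)) \<le> (\<Sum>k\<in>A. real (card (N k)))"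
    using card_UN_le[OF assms(1), of N] by (simp flip: of_nat_sum)
  also have "\<dots> \<le> (\<Sum>k\<in>A. c)" by (rule sum_mono) (rule assms(3))
  also have "\<dots> \<le> a * c" using assms by (simp add: mult_right_mono)
  finally show ?thesis .
qed

lemma polynomial_growth_nat:
  assumes "polynomial_growth V E b M Ws pW pG" "i \<in> V"
  shows "real (card {j\<in>V. gdist E i j \<le> enat n}) \<le> poly pG (real n)"
proof -
  have "ereal_of_enat x \<le> ereal (real n) \<longleftrightarrow> x \<le> enat n" for x
    using ereal_of_enat_le_iff[of x "enat n"] by simp
  moreover have "real (card {j\<in>V. ereal_of_enat (gdist E i j) \<le> ereal (real n)}) \<le> poly pG (real n)"
    using assms by (simp add: polynomial_growth_def)
  ultimately show ?thesis by simp
qed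

text \<open>The derived constant is smaller than the claimed one by the factors
  \<open>sqrt P\<close>, \<open>sqrt 2 / sqrt (1 - r\<^sup>2)\<close> and \<open>C / g\<close>, each
  at least 1. The \<open>r ^ 3\<close> in the denominator is \<open>r\<^sup>2\<close> from
  \<open>Ups_mu\<close> times \<open>r\<close> from \<open>Ups_mu_b\<close>.\<close>

lemma constants_le:
  fixes r :: real
  assumes r: "0 < r" "r < 1" and g: "0 < g" "g \<le> C" and t: "t \<le> r ^ b / r ^ 3"
    and P: "1 \<le> P" "0 \<le> Q"
  shows "t / g * C * sqrt (P * Q)
    \<le> sqrt 2 * (C / (g\<^sup>2 * r\<^sup>2)) * C / (r * sqrt (1 - r\<^sup>2)) * (P * sqrt Q) * r ^ b"
proof -
  have "r\<^sup>2 < 1" using r by (simp add: power_less_one_iff)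
  then have r2: "0 < 1 - r\<^sup>2" "1 - r\<^sup>2 \<le> 2" using zero_le_power2[of r] by linarith+
  define k where "k = r ^ b / r ^ 3 / g * C"
  have k: "0 \<le> k" using r g by (simp add: k_def)
  have "t / g * C * sqrt (P * Q) \<le> k * sqrt (P * Q)"
    unfolding k_def using t g P by (intro mult_right_mono divide_right_mono) auto
  also have "\<dots> \<le> k * (P * sqrt Q)"
  proof (rule mult_left_mono[OF _ k])
    have "sqrt P \<le> P" using P self_le_power[of P 2] by (intro real_le_lsqrt) auto
    then show "sqrt (P * Q) \<le> P * sqrt Q" using P by (simp add: real_sqrt_mult mult_right_mono)
  qed
  also have "\<dots> = 1 * (k * (P * sqrt Q))" by simp
  also have "\<dots> \<le> (sqrt 2 / sqrt (1 - r\<^sup>2) * (C / g)) * (k * (P * sqrt Q))"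
  proof (rule mult_right_mono)
    have "1 * 1 \<le> sqrt 2 / sqrt (1 - r\<^sup>2) * (C / g)"
      using r2 g by (intro mult_mono) (auto simp: le_divide_eq)
    then show "1 \<le> sqrt 2 / sqrt (1 - r\<^sup>2) * (C / g)" by simp
  qed (use k P in auto)
  also have "\<dots> = sqrt 2 * (C / (g\<^sup>2 * r\<^sup>2)) * C / (r * sqrt (1 - r\<^sup>2)) * (P * sqrt Q) * r ^ b"
    by (simp add: k_def power2_eq_square power3_eq_cube mult_ac)
  finally show ?thesis .
qed

section \<open>Assembling the local errors\<close>

lemma ball_add_subset:
  assumes "undirected_graph V E" "i \<in> V"
  shows "{j\<in>V. gdist E i j \<le> enat (m + n)}
    \<subseteq> (\<Union>k\<in>{k\<in>V. gdist E i k \<le> enat m}. {j\<in>V. gdist E k j \<le> enat n})"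
proof
  fix j assume j: "j \<in> {j\<in>V. gdist E i j \<le> enat (m + n)}"
  then obtain k where k: "gdist E i k \<le> enat m" "gdist E k j \<le> enat n"
    by (auto elim: gdist_split)
  have "k \<in> V" by (rule gdist_mem[OF assms k(1)])
  then show "j \<in> (\<Union>k\<in>{k\<in>V. gdist E i k \<le> enat m}. {j\<in>V. gdist E k j \<le> enat n})"
    using j k by blast
qed

lemma poly_ge_one:
  assumes "polynomial_growth V E b M Ws pW pG" "finite V" "i \<in> V"
  shows "1 \<le> poly pG 1"
proof -
  have "card {i} \<le> card {j\<in>V. gdist E i j \<le> enat 1}"
    using assms gdist_self by (intro card_mono) auto
  then show ?thesis using polynomial_growth_nat[OF assms(1,3), of 1] by simp
qed

text \<open>Covering the ball of radius two by unit balls around the unit ball gives the square of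
  \<open>poly pG 1\<close>, as in \<open>Ups_hat\<close>.\<close>

lemma card_ball_two_le:
  assumes "undirected_graph V E" "polynomial_growth V E b M Ws pW pG" "i \<in> V"
  shows "real (card {j\<in>V. gdist E i j \<le> enat 2}) \<le> (poly pG 1)\<^sup>2"
proof -
  have fin: "finite V" using assms(1) by (simp add: undirected_graph_def)
  have one: "real (card {j\<in>V. gdist E k j \<le> enat 1}) \<le> poly pG 1" if "k \<in> V" for k
    using polynomial_growth_nat[OF assms(2) that, of 1] by simp
  have "card {j\<in>V. gdist E i j \<le> enat (1 + 1)}
      \<le> card (\<Union>k\<in>{k\<in>V. gdist E i k \<le> enat 1}. {j\<in>V. gdist E k j \<le> enat 1})"
    using fin by (intro card_mono ball_add_subset[OF assms(1,3)]) auto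
  moreover have "real (card (\<Union>k\<in>{k\<in>V. gdist E i k \<le> enat 1}. {j\<in>V. gdist E k j \<le> enat 1})) \<le> poly pG 1 * poly pG 1"
  proof (rule card_UN_le_mult)
    show "0 \<le> poly pG 1" using poly_ge_one[OF assms(2) fin assms(3)] by simp
    show "real (card {k\<in>V. gdist E i k \<le> enat 1}) \<le> poly pG 1" by (rule one[OF assms(3)])
    show "real (card {j\<in>V. gdist E k j \<le> enat 1}) \<le> poly pG 1" if "k \<in> {k\<in>V. gdist E i k \<le> enat 1}" for k
      using that one by blast
  qed (use fin in simp)
  ultimately show ?thesis unfolding one_add_one power2_eq_square by linarith
qed

lemma part_subset_cover:
  assumes "overlapping_decomposition V E b M Vs Ws" "l \<in> {1..M}"
  shows "Vs l \<subseteq> V" "Vs l \<subseteq> Ws l" "Ws l \<subseteq> V"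
proof -
  show V: "Vs l \<subseteq> V" "Ws l \<subseteq> V"
    using assms unfolding overlapping_decomposition_def by blast+
  have "Vs l \<subseteq> closed_nbhd V E b (Vs l)"
  proof
    fix i assume "i \<in> Vs l"
    then show "i \<in> closed_nbhd V E b (Vs l)"
      using V(1) gdist_self[of E i b] unfolding mem_closed_nbhd_iff by blast
  qed
  then show "Vs l \<subseteq> Ws l"
    using assms unfolding overlapping_decomposition_def by blast
qed

lemma part_unique:
  assumes "overlapping_decomposition V E b M Vs Ws"
    and "k \<in> {1..M}" "i \<in> Vs k" "l \<in> {1..M}" "i \<in> Vs l"
  shows "k = l"
proof (rule ccontr)
  assume "k \<noteq> l"
  moreover have "disjoint_family_on Vs {1..M}"
    using assms(1) by (simp add: overlapping_decomposition_def)
  ultimately have "Vs k \<inter> Vs l = {}" using assms(2,4) by (simp add: disjoint_family_on_def)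
  then show False using assms(3,5) by blast
qed

lemma poly_cover_ge_one:
  assumes "undirected_graph V E" "polynomial_growth V E b M Ws pW pG"
    and "overlapping_decomposition V E b M Vs Ws" "i \<in> V"
  shows "1 \<le> poly pG (poly pW (real b))"
proof -
  obtain l where l: "l \<in> {1..M}" "i \<in> Vs l"
    using assms(3,4) unfolding overlapping_decomposition_def by blast
  then have "i \<in> Ws l" using part_subset_cover[OF assms(3)] by blast
  \<comment> \<open>This ensures that the ball of the possibly non-integer radius contains its
    centre.\<close>
  then have "ereal_of_enat (gdist E i i) \<le> ereal (poly pW (real b))"
    using assms(2) l(1) by (simp add: polynomial_growth_def)
  then have "card {i} \<le> card {j\<in>V. ereal_of_enat (gdist E i j) \<le> ereal (poly pW (real b))}"
    using assms(1,4) by (intro card_mono) (auto simp: undirected_graph_def)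
  moreover have "real (card {j\<in>V. ereal_of_enat (gdist E i j) \<le> ereal (poly pW (real b))}) \<le> poly pG (poly pW (real b))"
    using assms(2,4) by (simp add: polynomial_growth_def)
  ultimately show ?thesis by simp
qed

text \<open>
  A node within distance two of \<open>Ws l\<close> determines \<open>l\<close> through any representative of \<open>Vs l\<close>, which
  lies in \<open>Ws l\<close>.
\<close>

lemma card_covers_near_le:
  assumes graph: "undirected_graph V E" and growth: "polynomial_growth V E b M Ws pW pG"
    and dec: "overlapping_decomposition V E b M Vs Ws" and i: "i \<in> V"
  shows "real (card {l\<in>{l\<in>{1..M}. Vs l \<noteq> {}}. i \<in> closed_nbhd V E 2 (Ws l)})
    \<le> poly pG (poly pW (real b)) * poly pG (real b + 2)"
proof -
  define A where "A = {l\<in>{l\<in>{1..M}. Vs l \<noteq> {}}. i \<in> closed_nbhd V E 2 (Ws l)}"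
  define N where "N = (\<lambda>w. {v\<in>V. ereal_of_enat (gdist E w v) \<le> ereal (poly pW (real b))})"
  define D where "D = {w\<in>V. gdist E i w \<le> enat 2}"
  define v where "v = (\<lambda>l. SOME v. v \<in> Vs l)"
  have fin: "finite V" using graph by (simp add: undirected_graph_def)
  have v: "v l \<in> Vs l" if "l \<in> A" for l using that unfolding A_def v_def by (auto intro: someI)
  have "inj_on v A"
  proof (rule inj_onI)
    fix l l' assume l: "l \<in> A" "l' \<in> A" "v l = v l'"
    then have "v l \<in> Vs l" "v l \<in> Vs l'" using v[of l] v[of l'] by simp_all
    then show "l = l'" using l(1,2) part_unique[OF dec, of l "v l" l'] by (simp add: A_def)
  qed
  then have "card A = card (v ` A)" by (rule card_image[symmetric])
  also have "v ` A \<subseteq> (\<Union>w\<in>D. N w)"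
  proof
    fix x assume "x \<in> v ` A"
    then obtain l where l: "l \<in> A" "x = v l" by blast
    then have lM: "l \<in> {1..M}" and "i \<in> closed_nbhd V E 2 (Ws l)" by (auto simp: A_def)
    then obtain w where w: "w \<in> Ws l" "gdist E i w \<le> enat 2" unfolding mem_closed_nbhd_iff by blast
    have x: "x \<in> Vs l" using v l by simp
    then have "x \<in> V" "x \<in> Ws l" and wV: "w \<in> V" using part_subset_cover[OF dec lM] w(1) by auto
    then have "x \<in> N w" using growth lM w(1) by (simp add: N_def polynomial_growth_def)
    then show "x \<in> (\<Union>w\<in>D. N w)" using wV w(2) by (auto simp: D_def)
  qed
  then have "card (v ` A) \<le> card (\<Union>w\<in>D. N w)"
    using fin by (intro card_mono) (auto simp: D_def N_def)
  finally have "real (card A) \<le> real (card (\<Union>w\<in>D. N w))" by simp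
  also have "\<dots> \<le> poly pG (real b + 2) * poly pG (poly pW (real b))"
  proof (rule card_UN_le_mult)
    show "finite D" using fin by (simp add: D_def)
    \<comment> \<open>The ball itself is enlarged to radius \<open>b + 2\<close>, because
      \<open>pG\<close> is not assumed to be monotone.\<close>
    have "card D \<le> card {j\<in>V. gdist E i j \<le> enat (b + 2)}"
      using fin unfolding D_def by (intro card_mono) (auto elim: order_trans)
    then show "real (card D) \<le> poly pG (real b + 2)"
      using polynomial_growth_nat[OF growth i, of "b + 2"] by (simp add: add.commute)
    show "real (card (N w)) \<le> poly pG (poly pW (real b))" if "w \<in> D" for w
      using growth that by (simp add: N_def D_def polynomial_growth_def)
    show "0 \<le> poly pG (poly pW (real b))" using poly_cover_ge_one[OF graph growth dec i] by simp
  qed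
  finally show ?thesis by (simp add: A_def mult.commute)
qed

lemma card_part_eq_one:
  assumes "overlapping_decomposition V E b M Vs Ws" "i \<in> V"
  shows "card {l\<in>{l\<in>{1..M}. Vs l \<noteq> {}}. i \<in> Vs l} = 1"
proof -
  obtain l where l: "l \<in> {1..M}" "i \<in> Vs l"
    using assms unfolding overlapping_decomposition_def by blast
  have "{l\<in>{l\<in>{1..M}. Vs l \<noteq> {}}. i \<in> Vs l} = {l}"
  proof (intro equalityI subsetI)
    fix k assume "k \<in> {l\<in>{l\<in>{1..M}. Vs l \<noteq> {}}. i \<in> Vs l}"
    then have "k \<in> {1..M}" "i \<in> Vs k" by simp_all
    from part_unique[OF assms(1) this l] show "k \<in> {l}" by simp
  next
    fix k assume "k \<in> {l}"
    then show "k \<in> {l\<in>{l\<in>{1..M}. Vs l \<noteq> {}}. i \<in> Vs l}" using l by force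
  qed
  then show ?thesis by simp
qed

lemma subvec_assemble_diff:
  assumes "overlapping_decomposition V E b M Vs Ws" "l \<in> {1..M}"
  shows "subvec nd (assemble V nd M Vs w - d) (Vs l) = subvec nd (w l - d) (Vs l)"
proof -
  have "(THE k. k \<in> {1..M} \<and> i \<in> Vs k) = l" if "i \<in> Vs l" for i
  proof (rule the_equality)
    show "k = l" if "k \<in> {1..M} \<and> i \<in> Vs k" for k
      using part_unique[OF assms(1) _ _ assms(2) \<open>i \<in> Vs l\<close>] that by blast
  qed (use assms that in simp)
  then show ?thesis
    using part_subset_cover(1)[OF assms] by (auto simp: subvec_def assemble_def vec_eq_iff)
qed

section \<open>The decay rate\<close>

lemma rho_bounds:
  assumes "0 < gamma_K \<mu> \<gamma>H \<gamma>G \<Upsilon> pG" "gamma_K \<mu> \<gamma>H \<gamma>G \<Upsilon> pG < Ups_K \<mu> \<Upsilon> pG"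
  defines "\<theta> \<equiv> ((Ups_K \<mu> \<Upsilon> pG)\<^sup>2 - (gamma_K \<mu> \<gamma>H \<gamma>G \<Upsilon> pG)\<^sup>2) /
      ((Ups_K \<mu> \<Upsilon> pG)\<^sup>2 + (gamma_K \<mu> \<gamma>H \<gamma>G \<Upsilon> pG)\<^sup>2)"
  shows "0 < rho \<mu> \<gamma>H \<gamma>G \<Upsilon> pG" "rho \<mu> \<gamma>H \<gamma>G \<Upsilon> pG < 1"
    "\<theta> ^ (b div 4) \<le> rho \<mu> \<gamma>H \<gamma>G \<Upsilon> pG ^ b / rho \<mu> \<gamma>H \<gamma>G \<Upsilon> pG ^ 3"
proof -
  define C where "C = Ups_K \<mu> \<Upsilon> pG"
  define g where "g = gamma_K \<mu> \<gamma>H \<gamma>G \<Upsilon> pG"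
  define r where "r = rho \<mu> \<gamma>H \<gamma>G \<Upsilon> pG"
  have g: "0 < g" "g < C" using assms(1,2) by (simp_all add: g_def C_def)
  then have sq: "g\<^sup>2 < C\<^sup>2" "0 < g\<^sup>2" by (simp_all add: power_strict_mono)
  have \<theta>: "\<theta> = (C\<^sup>2 - g\<^sup>2) / (C\<^sup>2 + g\<^sup>2)" by (simp add: \<theta>_def C_def g_def)
  have t: "0 < \<theta>" unfolding \<theta> using sq by (intro divide_pos_pos) linarith+
  have t1: "\<theta> < 1" unfolding \<theta> using sq by (subst divide_less_eq_1_pos) linarith+
  have r: "r = \<theta> powr (1/4)" by (simp add: r_def rho_def \<theta>_def)
  have r4: "r ^ 4 = \<theta>" using t by (simp add: r powr_realpow[symmetric] powr_powr)
  show r0: "0 < rho \<mu> \<gamma>H \<gamma>G \<Upsilon> pG" using t by (simp add: r flip: r_def)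
  have "r < 1"
  proof (rule ccontr)
    assume "\<not> r < 1"
    then have "1 \<le> r ^ 4" by (simp add: one_le_power)
    then show False using t1 r4 by simp
  qed
  then show r1: "rho \<mu> \<gamma>H \<gamma>G \<Upsilon> pG < 1" by (simp add: r_def)
  \<comment> \<open>Rounding \<open>b\<close> down to a multiple of four loses at most three powers
    of \<open>r\<close>.\<close>
  have "\<theta> ^ (b div 4) * r ^ 3 = r ^ (4 * (b div 4) + 3)" by (simp add: power_add power_mult r4)
  also have "\<dots> \<le> r ^ b" using r0 r1 unfolding r_def[symmetric] by (intro power_decreasing) auto
  finally show "\<theta> ^ (b div 4) \<le> rho \<mu> \<gamma>H \<gamma>G \<Upsilon> pG ^ b / rho \<mu> \<gamma>H \<gamma>G \<Upsilon> pG ^ 3"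
    using r0 unfolding r_def[symmetric] by (simp add: le_divide_eq)
qed

section \<open>Summation of the local errors over the partition\<close>

theorem theorem3p9:
  fixes V :: "'v set" and E :: "('v \<times> 'v) set"
    and pn :: "'p::finite \<Rightarrow> 'v" and dn :: "'d::finite \<Rightarrow> 'v"
    and f :: "'v \<Rightarrow> real ^ 'p \<Rightarrow> real" and c :: "real ^ 'p \<Rightarrow> real ^ 'd"
    and x :: "nat \<Rightarrow> real ^ 'p" and lam :: "nat \<Rightarrow> real ^ 'd"
    and Hh H :: "nat \<Rightarrow> real ^ 'p ^ 'p" and G :: "nat \<Rightarrow> real ^ 'p ^ 'd"
    and gx :: "nat \<Rightarrow> real ^ 'p" and gl :: "nat \<Rightarrow> real ^ 'd"
    and b M \<tau> :: nat and Vs Ws :: "nat \<Rightarrow> 'v set"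
    and \<mu> \<gamma>H \<gamma>G \<Upsilon> :: real and pW pG :: "real poly"
    and \<omega> :: "nat \<Rightarrow> real ^ 'p" and \<zeta> :: "nat \<Rightarrow> real ^ 'd"
    and \<Delta>x \<Delta>x' :: "real ^ 'p" and \<Delta>l \<Delta>l' :: "real ^ 'd"
  defines "G \<equiv> \<lambda>t. jacobian c (at (x t))"
    and "H \<equiv> \<lambda>t. hessian (\<lambda>y. lagrangian V f c y (lam t)) (x t)"
    and "gx \<equiv> \<lambda>t. gradient (\<lambda>y. lagrangian V f c y (lam t)) (x t)"
    and "gl \<equiv> \<lambda>t. gradient (\<lambda>l. lagrangian V f c (x t) l) (lam t)"
  assumes problem: "graph_nlp V E pn dn f c"
    and Hh: "\<And>t. structured_hessian V E pn (Hh t)"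
    and decomposition: "overlapping_decomposition V E b M Vs Ws"
    and A1: "reduced_hessian_bound V pn \<gamma>H Hh G"
    and A2: "uniform_licq V dn \<gamma>G G"
    and A3: "block_bound V pn dn \<Upsilon> Hh H G"
    and A4: "polynomial_growth V E b M Ws pW pG"
    and mu: "\<mu> \<ge> mu_hat \<gamma>H \<gamma>G \<Upsilon> pG"
    and exact: "newton_direction V pn dn (Hh \<tau>) (G \<tau>) (gx \<tau>) (gl \<tau>) \<Delta>x \<Delta>l"
    and sub: "\<And>l. l \<in> {1..M} \<Longrightarrow>
      subproblem_solution V E pn dn (Hh \<tau>) (G \<tau>) (gx \<tau>) (c (x \<tau>)) \<mu> (Ws l) (\<omega> l) (\<zeta> l)"
    and approx: "\<Delta>x' = assemble V pn M Vs \<omega>" "\<Delta>l' = assemble V dn M Vs \<zeta>"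
  shows "norm (\<Delta>x' - \<Delta>x, \<Delta>l' - \<Delta>l)
    \<le> Ups_mu_b \<mu> b \<gamma>H \<gamma>G \<Upsilon> pW pG * rho \<mu> \<gamma>H \<gamma>G \<Upsilon> pG ^ b * norm (\<Delta>x, \<Delta>l)"
proof -
  have ixV: "indexed_by pn V \<Delta>x" "indexed_by dn V \<Delta>l"
    using exact by (auto simp: newton_direction_def)
  have errV: "indexed_by pn V (\<Delta>x' - \<Delta>x)" "indexed_by dn V (\<Delta>l' - \<Delta>l)"
    using ixV by (auto simp: approx indexed_by_def assemble_def)
  show ?thesis
  \<comment> \<open>Without a node the growth bounds say nothing about \<open>pG\<close>, but then
    all directions vanish.\<close>
  proof (cases "V = {}")
    case True
    have "\<Delta>x' - \<Delta>x = 0" "\<Delta>l' - \<Delta>l = 0" "\<Delta>x = 0" "\<Delta>l = 0"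
      using errV ixV by (simp_all add: True indexed_by_def vec_eq_iff)
    then show ?thesis by simp
  next
    case False
    then obtain i0 where i0: "i0 \<in> V" by blast
    have graph: "undirected_graph V E" using problem by (simp add: graph_nlp_def)
    then have fin: "finite V" and sym: "sym E" by (simp_all add: undirected_graph_def)
    define U where "U = Ups_hat \<Upsilon> pG"
    have U_ge: "1 \<le> \<Upsilon>" using A3 by (simp add: block_bound_def)
    have pG1: "1 \<le> poly pG 1" by (rule poly_ge_one[OF A4 fin i0])
    \<comment> \<open>Lets the Jacobian, whose blocks reach one edge only, share the constant
      \<open>U\<close> of the Hessian.\<close>
    then have pG2: "poly pG 1 \<le> (poly pG 1)\<^sup>2" by (rule self_le_power) simp
    have H_local: "pn p \<in> V \<and> pn q \<in> V \<and> gdist E (pn p) (pn q) \<le> enat 2" if "Hh \<tau> $ p $ q \<noteq> 0" for p q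
    proof (rule ccontr)
      assume "\<not> ?thesis"
      then have "pn p \<notin> V \<or> pn q \<notin> V \<or> gdist E (pn p) (pn q) > 2"
        by (auto simp: numeral_eq_enat not_le)
      then have "block pn pn (Hh \<tau>) (pn p) (pn q) = 0" using Hh[of \<tau>] unfolding structured_hessian_def by blast
      then show False using that block_eq_zeroD by blast
    qed
    have G_local: "dn d \<in> V \<and> pn p \<in> V \<and> gdist E (dn d) (pn p) \<le> enat 1" if "G \<tau> $ d $ p \<noteq> 0" for d p
      using constraint_jacobian_local[OF problem] that unfolding G_def by blast
    have H_norm: "norm (Hh \<tau> *v v) \<le> U * norm v" for v
      unfolding U_def Ups_hat_def
    proof (rule norm_matvec_le_blocks[where V = V and R = "\<lambda>i j. gdist E i j \<le> enat 2" and rd = pn and cd = pn])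
      show "spectral_norm (block pn pn (Hh \<tau>) i j) \<le> \<Upsilon>" if "i \<in> V" "j \<in> V" for i j
        using A3 that unfolding block_bound_def by blast
      show "real (card {j\<in>V. gdist E i j \<le> enat 2}) \<le> (poly pG 1)\<^sup>2" if "i \<in> V" for i
        by (rule card_ball_two_le[OF graph A4 that])
      show "gdist E j i \<le> enat 2" if "gdist E i j \<le> enat 2" for i j
        using that gdist_commute[OF sym, of i j] by simp
    qed (use fin U_ge H_local in auto)
    have G_norm: "norm (G \<tau> *v v) \<le> U * norm v" for v
      unfolding U_def Ups_hat_def
    proof (rule norm_matvec_le_blocks[where V = V and R = "\<lambda>i j. gdist E i j \<le> enat 1" and rd = dn and cd = pn])
      show "spectral_norm (block dn pn (G \<tau>) i j) \<le> \<Upsilon>" if "i \<in> V" "j \<in> V" for i j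
        using A3 that unfolding block_bound_def by blast
      show "real (card {j\<in>V. gdist E i j \<le> enat 1}) \<le> (poly pG 1)\<^sup>2" if "i \<in> V" for i
        using polynomial_growth_nat[OF A4 that, of 1] pG2 by simp
      show "gdist E j i \<le> enat 1" if "gdist E i j \<le> enat 1" for i j
        using that gdist_commute[OF sym, of i j] by simp
    qed (use fin U_ge G_local in auto)
    have const: "0 < \<gamma>H" "\<gamma>H \<le> 1" "0 < \<gamma>G" "\<gamma>G \<le> 1"
      using A1 A2 by (simp_all add: reduced_hessian_bound_def uniform_licq_def)
    have "1 * 1 \<le> \<Upsilon> * (poly pG 1)\<^sup>2" using U_ge pG1 pG2 by (intro mult_mono) auto
    then have U1: "1 \<le> U" by (simp add: U_def Ups_hat_def)
    have symH: "transpose (Hh \<tau>) = Hh \<tau>" using Hh by (simp add: structured_hessian_def)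
    interpret graph_kkt V E pn dn "Hh \<tau>" "G \<tau>" \<gamma>H \<gamma>G U \<mu>
    proof
      show "\<gamma>H * (norm v)\<^sup>2 \<le> v \<bullet> (Hh \<tau> *v v)" if "indexed_by pn V v" "G \<tau> *v v = 0" for v
        using A1 that by (simp add: reduced_hessian_bound_def)
      show "\<gamma>G * (norm l)\<^sup>2 \<le> (norm (transpose (G \<tau>) *v l))\<^sup>2" if "indexed_by dn V l" for l
      proof -
        have "\<gamma>G * (norm l)\<^sup>2 \<le> l \<bullet> ((G \<tau> ** transpose (G \<tau>)) *v l)"
          using A2 that by (simp add: uniform_licq_def)
        also have "\<dots> = (norm (transpose (G \<tau>) *v l))\<^sup>2"
          using inner_transpose[of "G \<tau>" "transpose (G \<tau>) *v l" l]
          by (simp add: matrix_vector_mul_assoc[symmetric] power2_norm_eq_inner inner_commute[of l])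
        finally show ?thesis .
      qed
      show "4 * U\<^sup>2 / (\<gamma>G * \<gamma>H) \<le> \<mu>" using mu by (simp add: mu_hat_def U_def)
    qed (fact graph symH H_local G_local H_norm G_norm const U1)+
    define C where "C = Ups_K \<mu> \<Upsilon> pG"
    define \<gamma> where "\<gamma> = gamma_K \<mu> \<gamma>H \<gamma>G \<Upsilon> pG"
    define \<theta> where "\<theta> = (C\<^sup>2 - \<gamma>\<^sup>2) / (C\<^sup>2 + \<gamma>\<^sup>2)"
    have CK: "CK = C" by (simp add: C_def Ups_K_def U_def)
    have gK: "\<gamma>H ^ 3 * \<gamma>G ^ 2 / (75 * C ^ 6) = \<gamma>" by (simp add: C_def \<gamma>_def gamma_K_def)
    have \<gamma>: "0 < \<gamma>" "\<gamma> \<le> 1" using gK_pos gK_le unfolding CK gK .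
    have "2 * U + \<mu> * U\<^sup>2 \<le> C" using CK_ge(1) unfolding CK .
    moreover have "0 \<le> \<mu> * U\<^sup>2" using mu_pos by simp
    \<comment> \<open>Strictness makes \<theta> positive, which positivity of \<open>rho\<close>
      relies on.\<close>
    ultimately have "1 < C" using U1 by linarith
    then have \<gamma>C: "\<gamma> < C" using \<gamma> by linarith
    define \<kappa> where "\<kappa> = \<theta> ^ (b div 4) / \<gamma> * C"
    have \<kappa>0: "0 \<le> \<kappa>"
    proof -
      have "0 \<le> \<theta> ^ (b div 4) / \<gamma>" using decay_factor_nonneg[of "b div 4"] unfolding CK gK \<theta>_def .
      moreover have "0 \<le> C" using \<open>1 < C\<close> by simp
      ultimately show ?thesis unfolding \<kappa>_def by (rule mult_nonneg_nonneg)
    qed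
    \<comment> \<open>Empty parts contribute no error, yet there may be arbitrarily many of them, so
      they are excluded before the covers are counted.\<close>
    define L where "L = {l\<in>{1..M}. Vs l \<noteq> {}}"
    define N where "N = (\<lambda>l. closed_nbhd V E 2 (Ws l))"
    have finL: "finite L" by (simp add: L_def)
    have cx: "gl \<tau> = c (x \<tau>)" by (simp add: gl_def gradient_dual)
    have loc: "norm (subvec pn (\<Delta>x' - \<Delta>x) (Vs l), subvec dn (\<Delta>l' - \<Delta>l) (Vs l))
      \<le> \<kappa> * norm (subvec pn \<Delta>x (N l), subvec dn \<Delta>l (N l))" if "l \<in> {1..M}" for l
    proof -
      interpret kkt_subproblem V E pn dn "Hh \<tau>" "G \<tau>" \<gamma>H \<gamma>G U \<mu> "Ws l"
        by unfold_locales (rule part_subset_cover[OF decomposition that])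
      note kkt = subproblem_kkt[OF sub[OF that] symH]
      \<comment> \<open>The stationarity equation carries a projection of the multiplier term; exact
        rows read variables in \<open>Ws l\<close> only, so it acts as the identity.\<close>
      have "indexed_by pn (Ws l) (Gt (\<zeta> l))"
        using Gt_PB_indexed[of "\<zeta> l"] kkt(2) by (simp add: subvec_eq_iff[THEN iffD2])
      then have Gz: "subvec pn (Gt (\<zeta> l)) (Ws l) = Gt (\<zeta> l)" by (simp add: subvec_eq_iff)
      have "norm (subvec pn (\<omega> l - \<Delta>x) (Vs l), subvec dn (\<zeta> l - \<Delta>l) (Vs l))
        \<le> ((CK\<^sup>2 - gK\<^sup>2) / (CK\<^sup>2 + gK\<^sup>2)) ^ (b div 4) / gK
            * (CK * norm (subvec pn \<Delta>x (closed_nbhd V E 2 (Ws l)), subvec dn \<Delta>l (closed_nbhd V E 2 (Ws l))))"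
      proof (rule local_error[where gx = "gx \<tau>" and cx = "c (x \<tau>)"])
        show "closed_nbhd V E b (Vs l) \<subseteq> Ws l" "1 \<le> b"
          using decomposition that by (auto simp: overlapping_decomposition_def)
        show "Hh \<tau> *v \<Delta>x + transpose (G \<tau>) *v \<Delta>l = - gx \<tau>" "G \<tau> *v \<Delta>x = - c (x \<tau>)"
          using exact by (simp_all add: newton_direction_def cx)
      qed (use part_subset_cover[OF decomposition that] kkt kkt(4)[unfolded Gz] in auto)
      then show ?thesis
        unfolding CK gK \<theta>_def[symmetric] N_def \<kappa>_def approx subvec_assemble_diff[OF decomposition that]
        by (simp only: mult.assoc)
    qed
    define P where "P = poly pG (poly pW (real b))"
    define B where "B = poly pG (real b + 2)"
    have P: "1 \<le> P" unfolding P_def by (rule poly_cover_ge_one[OF graph A4 decomposition i0])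
    have B: "0 \<le> B"
    proof -
      have "0 \<le> poly pG (real (b + 2))"
        by (rule order_trans[OF _ polynomial_growth_nat[OF A4 i0]]) simp
      then show ?thesis by (simp add: B_def add.commute)
    qed
    have cover: "real (card {l\<in>L. i \<in> N l}) \<le> P * B" if "i \<in> V" for i
      unfolding L_def N_def P_def B_def by (rule card_covers_near_le[OF graph A4 decomposition that])
    have part: "card {l\<in>L. i \<in> Vs l} = 1" if "i \<in> V" for i
      unfolding L_def by (rule card_part_eq_one[OF decomposition that])
    have pair: "(norm (u, v))\<^sup>2 = (norm u)\<^sup>2 + (norm v)\<^sup>2" for u :: "real ^ 'p" and v :: "real ^ 'd"
      by (simp add: norm_Pair)
    \<comment> \<open>On the left the parts are disjoint and the squares add up exactly; on the
      right the sets \<open>N l\<close> overlap, and each node is counted at most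
      \<open>P * B\<close> times.\<close>
    have "(norm (\<Delta>x' - \<Delta>x, \<Delta>l' - \<Delta>l))\<^sup>2
      = (\<Sum>l\<in>L. (norm (subvec pn (\<Delta>x' - \<Delta>x) (Vs l), subvec dn (\<Delta>l' - \<Delta>l) (Vs l)))\<^sup>2)"
      unfolding pair sum.distrib
      by (simp add: sum_norm_subvec_partition[OF finL errV(1) part] sum_norm_subvec_partition[OF finL errV(2) part])
    also have "\<dots> \<le> (\<Sum>l\<in>L. (\<kappa> * norm (subvec pn \<Delta>x (N l), subvec dn \<Delta>l (N l)))\<^sup>2)"
      by (intro sum_mono power_mono loc) (auto simp: L_def)
    also have "\<dots> = \<kappa>\<^sup>2 * ((\<Sum>l\<in>L. (norm (subvec pn \<Delta>x (N l)))\<^sup>2) + (\<Sum>l\<in>L. (norm (subvec dn \<Delta>l (N l)))\<^sup>2))"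
      unfolding power_mult_distrib pair by (simp only: sum_distrib_left[symmetric] sum.distrib)
    also have "\<dots> \<le> \<kappa>\<^sup>2 * (P * B * (norm \<Delta>x)\<^sup>2 + P * B * (norm \<Delta>l)\<^sup>2)"
      by (intro mult_left_mono add_mono sum_norm_subvec_le[OF finL ixV(1) cover] sum_norm_subvec_le[OF finL ixV(2) cover]) simp_all
    also have "\<dots> = (\<kappa> * sqrt (P * B) * norm (\<Delta>x, \<Delta>l))\<^sup>2"
      using P B unfolding power_mult_distrib pair by (simp add: algebra_simps)
    finally have "norm (\<Delta>x' - \<Delta>x, \<Delta>l' - \<Delta>l) \<le> \<kappa> * sqrt (P * B) * norm (\<Delta>x, \<Delta>l)"
      by (rule power2_le_imp_le) (use \<kappa>0 P B in simp)
    also have "\<kappa> * sqrt (P * B) \<le> Ups_mu_b \<mu> b \<gamma>H \<gamma>G \<Upsilon> pW pG * rho \<mu> \<gamma>H \<gamma>G \<Upsilon> pG ^ b"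
      unfolding Ups_mu_b_def Ups_mu_def C_def[symmetric] \<gamma>_def[symmetric] P_def[symmetric] B_def[symmetric] \<kappa>_def
    proof (rule constants_le)
      show "0 < rho \<mu> \<gamma>H \<gamma>G \<Upsilon> pG" "rho \<mu> \<gamma>H \<gamma>G \<Upsilon> pG < 1"
        using rho_bounds(1,2) \<gamma>(1) \<gamma>C unfolding C_def \<gamma>_def by blast+
      show "\<theta> ^ (b div 4) \<le> rho \<mu> \<gamma>H \<gamma>G \<Upsilon> pG ^ b / rho \<mu> \<gamma>H \<gamma>G \<Upsilon> pG ^ 3"
        using rho_bounds(3)[of \<mu> \<gamma>H \<gamma>G \<Upsilon> pG b] \<gamma>(1) \<gamma>C unfolding \<theta>_def C_def \<gamma>_def by blast
    qed (use \<gamma>(1) \<gamma>C P B in auto)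
    finally show ?thesis by (simp add: mult_right_mono)
  qed
qed

end
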